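(* Fix the number of types $k$ and the type parameters $(\lambda_j,v_j,p_j)_{j\in[k]}$. There exists a constant $M$ (depending only on $k$ and these parameters, not on $B$ or $T$) such that for every capacity $B$ and every horizon $T$, $$\mathbb{E}_{\vec A}\left[\widehat{\mathrm{OPT}}_{\vec A}-\mathrm{OBJ}_{\vec A}\right]\le M,$$ where $\widehat{\mathrm{OPT}}_{\vec A}$ is the clairvoyant general objective and $\mathrm{OBJ}_{\vec A}$ is the expected objective of the online index policy on the arrival sequence $\vec A$.
   Context: **Model.** $[k]=\{1,\dots,k\}$, $\mathbb N=\{0,1,2,\dots\}$. There are $k$ customer types; type $j$ has arrival probability $\lambda_j>0$ ($\sum_j\lambda_j=1$), revenue $0\le v_j<1$, and show-up probability $p_j\in\mathbb Q\cap(0,1]$. The critical ratio is $q_j=v_j/p_j$; it is assumed that $q_j<1$ for all $j$. Types are ordered so that $q_1\ge q_2\ge\dots\ge q_k$, and if $q_j=q_{j+1}$ then $v_j>v_{j+1}$ and $p_j>p_{j+1}$. The capacity is $B\in\mathbb N$, the horizon is a positive integer $T$. In each period $t=1,\dots,T$ one customer arrives, of type $A_t$, where $A_1,\dots,A_T$ are i.i.d. with $\mathbb P[A_t=j]=\lambda_j$; $\vec A=(A_1,\dots,A_T)$. Let $N_j[s,t]$ be the number of type $j$ arrivals in periods $s,\dots,t$. Each arrival is irrevocably accepted or rejected on arrival. For $m\in\mathbb N$, $X_{j,m}\sim \mathrm{Bin}(m,p_j)$, independent across $j$. For $\vec x\in\mathbb N^k$ let $V_B(\vec x)=\mathbb E\big[\big(\sum_{j}X_{j,x_j}-B\big)^+\big]$,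 the expected compensation. If in total $\vec x\in\mathbb N^k$ customers are accepted by the end of period $T$, the objective is $\sum_j v_jx_j-V_B(\vec x)$. **Offline problem.** Given past accepted customers $\vec y\in\mathbb N^k$ and future arrivals $\vec n\in\mathbb N^k$, the offline problem $P(\vec y,\vec n)$ is to maximize $\sum_j v_j(y_j+x_j)-V_B(\vec y+\vec x)$ over $\vec x\in\mathbb N^k$ with $0\le x_j\le n_j$ for all $j$. A feasible $\vec x$ is an *index solution* if there is a threshold index $\tilde j\in[k]$ with $x_j=n_j$ for all $j<\tilde j$ and $x_j=0$ for all $j>\tilde j$. An *optimal index solution* maximizes the objective among index solutions. **Clairvoyant general objective.** $\widehat{\mathrm{OPT}}_{\vec A}$ is the optimal value of $P(\vec 0,(N_j[1,T])_j)$ (over all feasible solutions). **Online index policy.** Initialize $\vec x[0]=\vec 0$. Draw once a vector $\vec A'$ of length $T$ with the same distribution as $\vec A$ and independent of it. In each period $t=1,\dots,T$: observe the type $j=A_t$; for every $j'\in[k]$ let $\widetilde N_{j'}[t]$ be the number of type $j'$ entries among $A'_{t+1},\dots,A'_T$, plus $1$ if $j'=j$; find an optimal index solution $\vec x'$ of $P(\vec x[t-1],\widetilde N[t])$; if $x'_j\ge \widetilde N_j[t]/2$, accept the arrival and set $x_j[t]=x_j[t-1]+1$; otherwise reject it and set $x_j[t]=x_j[t-1]$; set $x_{j'}[t]=x_{j'}[t-1]$ for $j'\ne j$. $\mathrm{OBJ}_{\vec A}$ denotes the expectation, over $\vec A'$, of the objective $\sum_jv_jx_j[T]-V_B(\vec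 x[T])$ obtained by this policy on arrival sequence $\vec A$. *)

theory Defs
  imports "HOL-Probability.Probability"
begin

text \<open>
  Customer types are the naturals \<^term>\<open>{1..k}\<close>. A vector over the types is a function
  \<^typ>\<open>nat \<Rightarrow> nat\<close> of which only the coordinates in \<^term>\<open>{1..k}\<close> are ever inspected; the decision
  vectors of the offline problem are extensional (\<^const>\<open>PiE\<close>), so that they form a finite set.
  An arrival sequence is a function from periods to types, indexed by \<^term>\<open>{1..T}\<close>.
\<close>

definition valid_params :: "nat \<Rightarrow> (nat \<Rightarrow> real) \<Rightarrow> (nat \<Rightarrow> real) \<Rightarrow> (nat \<Rightarrow> real) \<Rightarrow> bool" where
  "valid_params k lam v p \<longleftrightarrow>
     (\<forall>j\<in>{1..k}. 0 < lam j) \<and> (\<Sum>j\<in>{1..k}. lam j) = 1 \<and>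
     (\<forall>j\<in>{1..k}. 0 \<le> v j \<and> v j < 1) \<and>
     (\<forall>j\<in>{1..k}. p j \<in> \<rat> \<and> 0 < p j \<and> p j \<le> 1) \<and>
     (\<forall>j\<in>{1..k}. v j / p j < 1) \<and>
     (\<forall>j\<in>{1..<k}. v j / p j \<ge> v (j + 1) / p (j + 1)) \<and>
     (\<forall>j\<in>{1..<k}. v j / p j = v (j + 1) / p (j + 1) \<longrightarrow> v j > v (j + 1) \<and> p j > p (j + 1))"

definition type_pmf :: "nat \<Rightarrow> (nat \<Rightarrow> real) \<Rightarrow> nat pmf" where
  "type_pmf k lam = embed_pmf (\<lambda>j. if j \<in> {1..k} then lam j else 0)"

definition arrivals_pmf :: "nat \<Rightarrow> (nat \<Rightarrow> real) \<Rightarrow> nat \<Rightarrow> (nat \<Rightarrow> nat) pmf" where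
  "arrivals_pmf k lam T = Pi_pmf {1..T} 0 (\<lambda>_. type_pmf k lam)"

definition arrival_count :: "(nat \<Rightarrow> nat) \<Rightarrow> nat \<Rightarrow> nat \<Rightarrow> nat \<Rightarrow> nat" where
  "arrival_count A s t j = card {u \<in> {s..t}. A u = j}"

definition compensation :: "nat \<Rightarrow> (nat \<Rightarrow> real) \<Rightarrow> nat \<Rightarrow> (nat \<Rightarrow> nat) \<Rightarrow> real" where
  "compensation k p B x =
     measure_pmf.expectation (Pi_pmf {1..k} 0 (\<lambda>j. binomial_pmf (x j) (p j)))
       (\<lambda>X. max 0 ((\<Sum>j\<in>{1..k}. real (X j)) - real B))"

definition objective ::
  "nat \<Rightarrow> (nat \<Rightarrow> real) \<Rightarrow> (nat \<Rightarrow> real) \<Rightarrow> nat \<Rightarrow> (nat \<Rightarrow> nat) \<Rightarrow> real" where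
  "objective k v p B x = (\<Sum>j\<in>{1..k}. v j * real (x j)) - compensation k p B x"

definition offline_feasible :: "nat \<Rightarrow> (nat \<Rightarrow> nat) \<Rightarrow> (nat \<Rightarrow> nat) set" where
  "offline_feasible k n = (\<Pi>\<^sub>E j\<in>{1..k}. {0..n j})"

definition offline_objective ::
  "nat \<Rightarrow> (nat \<Rightarrow> real) \<Rightarrow> (nat \<Rightarrow> real) \<Rightarrow> nat \<Rightarrow> (nat \<Rightarrow> nat) \<Rightarrow> (nat \<Rightarrow> nat) \<Rightarrow> real" where
  "offline_objective k v p B y x = objective k v p B (\<lambda>j. y j + x j)"

definition index_solution :: "nat \<Rightarrow> (nat \<Rightarrow> nat) \<Rightarrow> (nat \<Rightarrow> nat) \<Rightarrow> bool" where
  "index_solution k n x \<longleftrightarrow> x \<in> offline_feasible k n \<and>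
     (\<exists>j0\<in>{1..k}. \<forall>j\<in>{1..k}. (j < j0 \<longrightarrow> x j = n j) \<and> (j > j0 \<longrightarrow> x j = 0))"

definition optimal_index_solution ::
  "nat \<Rightarrow> (nat \<Rightarrow> real) \<Rightarrow> (nat \<Rightarrow> real) \<Rightarrow> nat \<Rightarrow>
   (nat \<Rightarrow> nat) \<Rightarrow> (nat \<Rightarrow> nat) \<Rightarrow> (nat \<Rightarrow> nat) \<Rightarrow> bool" where
  "optimal_index_solution k v p B y n x \<longleftrightarrow> index_solution k n x \<and>
     (\<forall>x'. index_solution k n x' \<longrightarrow>
        offline_objective k v p B y x' \<le> offline_objective k v p B y x)"

definition clairvoyant_opt ::
  "nat \<Rightarrow> (nat \<Rightarrow> real) \<Rightarrow> (nat \<Rightarrow> real) \<Rightarrow> nat \<Rightarrow> nat \<Rightarrow> (nat \<Rightarrow> nat) \<Rightarrow> real" where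
  "clairvoyant_opt k v p B T A =
     Max (offline_objective k v p B (\<lambda>_. 0) ` offline_feasible k (arrival_count A 1 T))"

definition estimated_arrivals ::
  "nat \<Rightarrow> (nat \<Rightarrow> nat) \<Rightarrow> (nat \<Rightarrow> nat) \<Rightarrow> nat \<Rightarrow> nat \<Rightarrow> nat" where
  "estimated_arrivals T A A' t j = arrival_count A' (t + 1) T j + (if j = A t then 1 else 0)"

text \<open>
  Optimal index solutions need not be unique. A selection rule resolves the choice in each period;
  besides the instance \<open>(y, n)\<close> it may use the information available to the policy, namely the
  arrivals observed so far (a list, in order) and the sampled sequence \<open>A'\<close>.
\<close>

type_synonym selection_rule =
  "nat list \<Rightarrow> (nat \<Rightarrow> nat) \<Rightarrow> (nat \<Rightarrow> nat) \<Rightarrow> (nat \<Rightarrow> nat) \<Rightarrow> (nat \<Rightarrow> nat)"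

definition valid_selection ::
  "nat \<Rightarrow> (nat \<Rightarrow> real) \<Rightarrow> (nat \<Rightarrow> real) \<Rightarrow> nat \<Rightarrow> selection_rule \<Rightarrow> bool" where
  "valid_selection k v p B sel \<longleftrightarrow>
     (\<forall>h A' y n. optimal_index_solution k v p B y n (sel h A' y n))"

fun policy_state ::
  "nat \<Rightarrow> selection_rule \<Rightarrow> (nat \<Rightarrow> nat) \<Rightarrow> (nat \<Rightarrow> nat) \<Rightarrow> nat \<Rightarrow> (nat \<Rightarrow> nat)" where
  "policy_state T sel A A' 0 = (\<lambda>_. 0)"
| "policy_state T sel A A' (Suc t) =
     (let y = policy_state T sel A A' t;
          j = A (Suc t);
          n = estimated_arrivals T A A' (Suc t);
          x' = sel (map A [1..<Suc (Suc t)]) A' y n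
      in if real (x' j) \<ge> real (n j) / 2 then y(j := y j + 1) else y)"

definition policy_obj ::
  "nat \<Rightarrow> (nat \<Rightarrow> real) \<Rightarrow> (nat \<Rightarrow> real) \<Rightarrow> (nat \<Rightarrow> real) \<Rightarrow> nat \<Rightarrow> nat \<Rightarrow> selection_rule \<Rightarrow>
   (nat \<Rightarrow> nat) \<Rightarrow> real" where
  "policy_obj k lam v p B T sel A =
     measure_pmf.expectation (arrivals_pmf k lam T)
       (\<lambda>A'. objective k v p B (policy_state T sel A A' T))"

lemma pmf_type_pmf:
  assumes "valid_params k lam v p"
  shows "pmf (type_pmf k lam) j = (if j \<in> {1..k} then lam j else 0)"
  unfolding type_pmf_def
proof (rule pmf_embed_pmf)
  show "\<And>x. 0 \<le> (if x \<in> {1..k} then lam x else 0)"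
    using assms by (auto simp: valid_params_def less_imp_le)
  have "(\<integral>\<^sup>+x. ennreal (if x \<in> {1..k} then lam x else 0) \<partial>count_space UNIV)
      = (\<Sum>x\<in>{1..k}. ennreal (lam x))"
    by (subst nn_integral_count_space'[where A = "{1..k}"]) auto
  also have "\<dots> = ennreal (\<Sum>x\<in>{1..k}. lam x)"
    using assms by (intro sum_ennreal) (auto simp: valid_params_def less_imp_le)
  finally show "(\<integral>\<^sup>+x. ennreal (if x \<in> {1..k} then lam x else 0) \<partial>count_space UNIV) = 1"
    using assms by (simp add: valid_params_def)
qed

lemma valid_selection_exists:
  assumes "1 \<le> k"
  shows "\<exists>sel. valid_selection k v p B sel"
proof -
  have "\<exists>x. optimal_index_solution k v p B y n x" for y n
  proof -
    let ?S = "{x. index_solution k n x}"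
    have fin: "finite ?S"
      by (rule finite_subset[of _ "offline_feasible k n"])
         (auto simp: index_solution_def offline_feasible_def intro!: finite_PiE)
    have "(\<lambda>j\<in>{1..k}. 0) \<in> ?S"
      using assms by (auto simp: index_solution_def offline_feasible_def intro!: bexI[of _ 1])
    then obtain x where "x \<in> ?S"
      "Max (offline_objective k v p B y ` ?S) = offline_objective k v p B y x"
      using Max_in[of "offline_objective k v p B y ` ?S"] fin by blast
    with fin have "optimal_index_solution k v p B y n x"
      by (auto simp: optimal_index_solution_def dest!: sym[of "Max _"])
    then show ?thesis by blast
  qed
  then have "valid_selection k v p B (\<lambda>h A' y n. SOME x. optimal_index_solution k v p B y n x)"
    unfolding valid_selection_def by (metis someI_ex)
  then show ?thesis by blast
qed

end

theory Submission
  imports Defs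
begin

text \<open>
  Along the greedy order of types, a customer of type \<open>j\<close> has marginal value \<open>p j * (q j - P)\<close>, where
  \<open>P\<close> is the probability that the capacity is already exhausted. Let \<open>OPT\<close> be the optimal index value of the
  offline problem given the current state and the true future arrivals. A decision of the policy is
  optimal for the sampled future, and it is at least half of the remaining type \<open>j\<close> customers away
  from the point where it would be wrong. If the true and sampled counts differ little, this margin
  absorbs the difference, so one period decreases \<open>OPT\<close> by at most
  \<open>exp (\<theta> * (\<Sum>i. \<bar>N i - N' i\<bar> - p j * N' j / 4 + 1 / 4))\<close>. Its expectation decays geometrically in the number of
  remaining periods, and telescoping bounds the loss of the policy against the optimal index value.
  The latter differs from the general optimum by a constant.
\<close>

subsection \<open>Sums of independent Bernoulli variables\<close>

text \<open>The obstacle is dependence: one sample serves all periods, so the state of the policy is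
  correlated with the past arrivals and with the sample that it still uses for the future. The loss
  of a period is therefore bounded for every state \<open>y\<close> and every optimal index solution
  at once, by \<open>deviation\<close>, which involves only the current type and the true and
  sampled counts of later periods. Once the current type is summed out, independence of arrivals and
  sample is all that remains to be used. Exponential moments are needed because the losses must be
  summable over the horizon; a second-moment bound of order 1 / n per period would only give a
  logarithm.\<close>

text \<open>\<open>bern p\<close> is the transition operator of adding an independent Bernoulli variable, so that
  \<open>berns M \<phi> t\<close> is the expectation of \<open>\<phi> (t + S)\<close> for a sum \<open>S\<close> of independent Bernoulli variables
  whose parameters are the elements of \<open>M\<close>.\<close>

definition bern :: "real \<Rightarrow> (real \<Rightarrow> real) \<Rightarrow> real \<Rightarrow> real" where
  "bern p \<phi> t = (1 - p) * \<phi> t + p * \<phi> (t + 1)"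

interpretation bern: comp_fun_commute bern
  by unfold_locales (auto simp: bern_def fun_eq_iff algebra_simps)

definition berns :: "real multiset \<Rightarrow> (real \<Rightarrow> real) \<Rightarrow> real \<Rightarrow> real" where
  "berns M \<phi> = fold_mset bern \<phi> M"

lemma berns_empty [simp]: "berns {#} \<phi> = \<phi>"
  by (simp add: berns_def)

lemma berns_add_mset: "berns (add_mset p M) \<phi> = bern p (berns M \<phi>)"
  by (simp add: berns_def)

lemma berns_add_mset': "berns (add_mset p M) \<phi> = berns M (bern p \<phi>)"
  by (simp add: berns_def bern.fold_mset_fun_left_comm)

lemma berns_union: "berns (M + N) \<phi> = berns M (berns N \<phi>)"
  by (simp add: berns_def add.commute[of M N])

definition prob_mset :: "real multiset \<Rightarrow> bool" where
  "prob_mset M \<longleftrightarrow> (\<forall>p\<in>#M. 0 \<le> p \<and> p \<le> 1)"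

lemma prob_mset_simps [simp]:
  "prob_mset {#}"
  "prob_mset (add_mset p M) \<longleftrightarrow> 0 \<le> p \<and> p \<le> 1 \<and> prob_mset M"
  "prob_mset (M + N) \<longleftrightarrow> prob_mset M \<and> prob_mset N"
  by (auto simp: prob_mset_def)

lemma prob_mset_replicate [simp]: "0 \<le> p \<Longrightarrow> p \<le> 1 \<Longrightarrow> prob_mset (replicate_mset n p)"
  by (auto simp: prob_mset_def)

lemma sum_mset_prob_nonneg: "prob_mset M \<Longrightarrow> 0 \<le> sum_mset M"
  by (induction M) auto

lemma berns_mono:
  assumes "prob_mset M" "\<And>t. \<phi> t \<le> \<psi> t"
  shows "berns M \<phi> t \<le> berns M \<psi> t"
  using assms(1)
proof (induction M arbitrary: t)
  case (add p M)
  then show ?case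
    by (auto simp: berns_add_mset bern_def intro!: add_mono mult_left_mono)
qed (simp add: assms(2))

lemma berns_linear: "berns M (\<lambda>t. a * \<phi> t + b * \<psi> t) t = a * berns M \<phi> t + b * berns M \<psi> t"
  by (induction M arbitrary: t) (auto simp: berns_add_mset bern_def algebra_simps)

lemma berns_const [simp]: "berns M (\<lambda>_. c) t = c"
  by (induction M arbitrary: t) (auto simp: berns_add_mset bern_def algebra_simps)

lemma berns_add_const: "berns M (\<lambda>t. \<phi> t + c) t = berns M \<phi> t + c"
  using berns_linear[of M 1 \<phi> 1 "\<lambda>_. c" t] by simp

lemma berns_shift: "berns M (\<lambda>t. \<phi> (t + c)) t = berns M \<phi> (t + c)"
  by (induction M arbitrary: t) (auto simp: berns_add_mset bern_def algebra_simps)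

lemma berns_replicate_one: "berns (replicate_mset n 1) \<phi> t = \<phi> (t + real n)"
  by (induction n arbitrary: t) (auto simp: berns_add_mset bern_def algebra_simps)

lemma mono_berns:
  assumes "prob_mset M" "mono \<phi>"
  shows "mono (berns M \<phi>)"
  using assms(1)
proof (induction M)
  case (add p M)
  then show ?case
    by (auto simp: berns_add_mset bern_def mono_def intro!: add_mono mult_left_mono)
qed (simp add: assms(2))

lemma berns_ge:
  assumes "prob_mset M" "mono \<phi>"
  shows "\<phi> t \<le> berns M \<phi> t"
  using assms(1)
proof (induction M)
  case (add p M)
  have "mono (berns M \<phi>)" using add assms(2) by (auto intro: mono_berns)
  then have "berns M \<phi> t \<le> berns M \<phi> (t + 1)" by (simp add: monoD)
  then have "p * berns M \<phi> t \<le> p * berns M \<phi> (t + 1)" using add by (auto intro: mult_left_mono)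
  then have "berns M \<phi> t \<le> bern p (berns M \<phi>) t" by (simp add: bern_def algebra_simps)
  with add show ?case by (auto simp: berns_add_mset)
qed simp

lemma berns_le_shift:
  assumes "prob_mset M" "mono \<phi>"
  shows "berns M \<phi> t \<le> \<phi> (t + real (size M))"
  using assms(1)
proof (induction M arbitrary: t)
  case (add p M)
  have m: "mono (berns M \<phi>)" using add assms(2) by (auto intro: mono_berns)
  then have "berns M \<phi> t \<le> berns M \<phi> (t + 1)" by (simp add: monoD)
  then have "(1 - p) * berns M \<phi> t \<le> (1 - p) * berns M \<phi> (t + 1)"
    using add by (auto intro: mult_left_mono)
  then have "bern p (berns M \<phi>) t \<le> berns M \<phi> (t + 1)" by (simp add: bern_def algebra_simps)
  also have "\<dots> \<le> \<phi> (t + 1 + real (size M))" using add by simp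
  finally show ?case by (simp add: berns_add_mset add_ac)
qed simp

text \<open>These properties of \<open>excess\<close> survive averaging over Bernoulli variables
  (\<open>icx_berns\<close>): convexity drives \<open>berns_majorization\<close> and
  \<open>berns_jensen\<close>, the Lipschitz bound pays for rounding means.\<close>

definition icx :: "(real \<Rightarrow> real) \<Rightarrow> bool" where
  "icx \<phi> \<longleftrightarrow> mono \<phi> \<and> convex_on UNIV \<phi> \<and> (\<forall>s t. s \<le> t \<longrightarrow> \<phi> t - \<phi> s \<le> t - s)"

lemma icx_bern:
  assumes "icx \<phi>" "0 \<le> p" "p \<le> 1"
  shows "icx (bern p \<phi>)"
proof -
  have cx: "convex_on UNIV \<phi>" using assms by (simp add: icx_def)
  have cx': "convex_on UNIV (\<lambda>t. \<phi> (t + 1))"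
  proof (rule convex_onI)
    fix t x y :: real assume t: "0 < t" "t < 1"
    have "\<phi> ((1 - t) *\<^sub>R (x + 1) + t *\<^sub>R (y + 1)) \<le> (1 - t) * \<phi> (x + 1) + t * \<phi> (y + 1)"
      using t by (intro convex_onD[OF cx]) auto
    then show "\<phi> ((1 - t) *\<^sub>R x + t *\<^sub>R y + 1) \<le> (1 - t) * \<phi> (x + 1) + t * \<phi> (y + 1)"
      by (simp add: algebra_simps)
  qed simp
  have "convex_on UNIV (\<lambda>t. (1 - p) * \<phi> t + p * \<phi> (t + 1))"
    using assms cx cx' by (intro convex_on_add convex_on_cmul) auto
  then have "convex_on UNIV (bern p \<phi>)"
    by (simp add: bern_def[abs_def])
  moreover have "mono (bern p \<phi>)"
    using mono_berns[of "{#p#}" \<phi>] assms by (simp add: icx_def berns_add_mset)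
  moreover have "bern p \<phi> t - bern p \<phi> s \<le> t - s" if "s \<le> t" for s t
  proof -
    have "(1 - p) * (\<phi> t - \<phi> s) + p * (\<phi> (t + 1) - \<phi> (s + 1)) \<le> (1 - p) * (t - s) + p * (t - s)"
      using assms that unfolding icx_def
      by (intro add_mono mult_left_mono) (auto dest: spec2[of _ "s + 1" "t + 1"])
    then show ?thesis by (simp add: bern_def algebra_simps)
  qed
  ultimately show ?thesis by (simp add: icx_def)
qed

lemma icx_berns: "icx \<phi> \<Longrightarrow> prob_mset M \<Longrightarrow> icx (berns M \<phi>)"
  by (induction M) (auto simp: berns_add_mset intro: icx_bern)

lemma icx_midpoint:
  assumes "icx \<phi>"
  shows "2 * \<phi> (t + 1) \<le> \<phi> t + \<phi> (t + 2)"
proof -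
  have "\<phi> ((1 - 1/2) *\<^sub>R t + (1/2) *\<^sub>R (t + 2)) \<le> (1 - 1/2) * \<phi> t + 1/2 * \<phi> (t + 2)"
    using assms by (intro convex_onD) (auto simp: icx_def)
  moreover have "(1 - 1/2) *\<^sub>R t + (1/2) *\<^sub>R (t + 2) = t + 1" by (simp add: field_simps)
  ultimately show ?thesis by simp
qed

text \<open>Expanded in finite differences, two Bernoulli variables enter only through the sum and
  the product of their parameters. The product multiplies a second difference, nonnegative by
  convexity, so equalizing two parameters raises the expectation.\<close>

lemma bern_transfer_le:
  assumes "icx \<phi>" "a + b = a' + b'" "a * b \<le> a' * b'"
  shows "bern a (bern b \<phi>) t \<le> bern a' (bern b' \<phi>) t"
proof -
  have eq: "bern c (bern d \<phi>) t =
      \<phi> t + (c + d) * (\<phi> (t + 1) - \<phi> t) + c * d * (\<phi> (t + 2) - 2 * \<phi> (t + 1) + \<phi> t)" for c d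
    by (simp add: bern_def algebra_simps)
  have "a * b * (\<phi> (t + 2) - 2 * \<phi> (t + 1) + \<phi> t) \<le> a' * b' * (\<phi> (t + 2) - 2 * \<phi> (t + 1) + \<phi> t)"
    using icx_midpoint[OF assms(1), of t] assms(3) by (intro mult_right_mono) auto
  then show ?thesis by (simp add: eq assms(2))
qed

text \<open>All Bernoulli parameters in \<open>X\<close> are above those in \<open>Y\<close>, so \<open>Y\<close> is more spread out and dominates
  in the increasing convex order. The extra parameter \<open>r\<close> makes the induction over \<open>Y\<close> go through: each
  \<open>y\<close> is split off from \<open>r\<close>, or produced by equalizing \<open>r\<close> with some element of \<open>X\<close>.\<close>

lemma berns_majorization:
  assumes "icx \<phi>" "0 \<le> r" "r \<le> 1" "\<And>x. x \<in># X \<Longrightarrow> c \<le> x \<and> x \<le> 1"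
    and "\<And>y. y \<in># Y \<Longrightarrow> 0 \<le> y \<and> y \<le> c" "0 \<le> c" "c \<le> 1" "r + sum_mset X \<le> sum_mset Y"
  shows "berns (add_mset r X) \<phi> t \<le> berns Y \<phi> t"
  using assms
proof (induction Y arbitrary: r X \<phi> t)
  case empty
  have X: "prob_mset X" using empty.prems(4,6) by (force simp: prob_mset_def)
  have "r = 0" "sum_mset X = 0"
    using empty.prems(2,8) sum_mset_prob_nonneg[OF X] by auto
  moreover have "berns X \<phi> t = \<phi> t" if "prob_mset X" "sum_mset X = 0" for X
    using that
  proof (induction X)
    case (add x X)
    then have "0 \<le> x" "0 \<le> sum_mset X" using sum_mset_prob_nonneg[of X] by auto
    then have "x = 0" "sum_mset X = 0" using add.prems by auto
    then show ?case using add by (simp add: berns_add_mset bern_def)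
  qed simp
  ultimately show ?case using X by (simp add: berns_add_mset bern_def)
next
  case (add y Y)
  have X: "prob_mset X" using add.prems(4,6) by (force simp: prob_mset_def)
  have Y: "prob_mset Y" using add.prems(5,7) by (force simp: prob_mset_def)
  have y: "0 \<le> y" "y \<le> c" using add.prems(5) by auto
  have icy: "icx (bern y \<phi>)" using add.prems(1,7) y by (intro icx_bern) auto
  have IH: "berns (add_mset s Z) (bern y \<phi>) t \<le> berns Y (bern y \<phi>) t"
    if "0 \<le> s" "s \<le> 1" "\<And>x. x \<in># Z \<Longrightarrow> c \<le> x \<and> x \<le> 1" "s + sum_mset Z \<le> sum_mset Y" for s Z
    using add.prems(5,6,7) that by (intro add.IH[OF icy]) auto
  show ?case
  proof (cases "y \<le> r")
    case True
    \<comment> \<open>A parameter 0 acts as the identity; inserting it lets the pair (0, r) be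
      equalized to (r - y, y).\<close>
    have "berns (add_mset r X) \<phi> t = berns X (bern 0 (bern r \<phi>)) t"
      by (simp add: berns_add_mset') (simp add: bern_def[abs_def])
    also have "\<dots> \<le> berns X (bern (r - y) (bern y \<phi>)) t"
      using True y by (intro berns_mono[OF X] bern_transfer_le[OF add.prems(1)]) auto
    also have "\<dots> = berns (add_mset (r - y) X) (bern y \<phi>) t"
      by (simp add: berns_add_mset')
    also have "\<dots> \<le> berns Y (bern y \<phi>) t"
      using add.prems(3,4,8) True y by (intro IH) auto
    finally show ?thesis by (simp add: berns_add_mset')
  next
    case False
    show ?thesis
    proof (cases X)
      case empty
      \<comment> \<open>With nothing left to equalize, monotonicity suffices: raise \<open>r\<close>
        to \<open>y\<close>, then add the rest of \<open>Y\<close>.\<close>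
      have "berns (add_mset r X) \<phi> t = bern r \<phi> t" by (simp add: empty berns_add_mset)
      also have "\<dots> \<le> bern y \<phi> t"
      proof -
        have "0 \<le> (y - r) * (\<phi> (t + 1) - \<phi> t)"
          using False add.prems(1) by (intro mult_nonneg_nonneg) (auto simp: icx_def mono_def)
        then show ?thesis by (simp add: bern_def algebra_simps)
      qed
      also have "\<dots> \<le> berns Y (bern y \<phi>) t"
        using Y icy by (intro berns_ge) (auto simp: icx_def)
      finally show ?thesis by (simp add: berns_add_mset')
    next
      case (add x X')
      have x: "c \<le> x" "x \<le> 1" using add.prems(4) add by auto
      have X': "prob_mset X'" using X add by simp
      have "berns (add_mset r X) \<phi> t = berns X' (bern r (bern x \<phi>)) t"
        by (simp add: add berns_add_mset' bern.fun_left_comm)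
      also have "\<dots> \<le> berns X' (bern (r + x - y) (bern y \<phi>)) t"
      proof (intro berns_mono[OF X'] bern_transfer_le[OF add.prems(1)])
        have "0 \<le> (y - r) * (x - y)" using False x y by (intro mult_nonneg_nonneg) auto
        then show "r * x \<le> (r + x - y) * y" by (simp add: algebra_simps)
      qed auto
      also have "\<dots> = berns (add_mset (r + x - y) X') (bern y \<phi>) t"
        by (simp add: berns_add_mset')
      also have "\<dots> \<le> berns Y (bern y \<phi>) t"
      proof (intro IH)
        show "0 \<le> r + x - y" "r + x - y \<le> 1" using add.prems(2) False x y by linarith+
        show "r + x - y + sum_mset X' \<le> sum_mset Y" using add.prems(8) add by simp
      qed (use add.prems(4) add in auto)
      finally show ?thesis by (simp add: berns_add_mset')
    qed
  qed
qed

lemma berns_jensen: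
  assumes "icx \<phi>" "prob_mset M"
  shows "\<phi> (t + sum_mset M) \<le> berns M \<phi> t"
  using assms(2)
proof (induction M arbitrary: t)
  case (add p M)
  have "\<phi> (t + sum_mset (add_mset p M)) = \<phi> ((1 - p) *\<^sub>R (t + sum_mset M) + p *\<^sub>R (t + 1 + sum_mset M))"
    by (simp add: algebra_simps)
  also have "\<dots> \<le> (1 - p) * \<phi> (t + sum_mset M) + p * \<phi> (t + 1 + sum_mset M)"
    using assms(1) add.prems by (intro convex_onD) (auto simp: icx_def)
  also have "\<dots> \<le> (1 - p) * berns M \<phi> t + p * berns M \<phi> (t + 1)"
    using add by (intro add_mono mult_left_mono) auto
  finally show ?case by (simp add: berns_add_mset bern_def)
qed simp

text \<open>Squared bias plus variance; the variance \<open>p * (1 - p)\<close> of each variable is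
  relaxed to \<open>p\<close>, so that only the mean enters.\<close>

lemma berns_square_le:
  assumes "prob_mset M"
  shows "berns M (\<lambda>s. (s - a)\<^sup>2) t \<le> (t + sum_mset M - a)\<^sup>2 + sum_mset M"
  using assms
proof (induction M arbitrary: t)
  case (add p M)
  have "berns (add_mset p M) (\<lambda>s. (s - a)\<^sup>2) t
    \<le> (1 - p) * ((t + sum_mset M - a)\<^sup>2 + sum_mset M) + p * ((t + 1 + sum_mset M - a)\<^sup>2 + sum_mset M)"
    unfolding berns_add_mset bern_def using add by (intro add_mono mult_left_mono) auto
  also have "\<dots> = (t + sum_mset (add_mset p M) - a)\<^sup>2 + sum_mset M + p * (1 - p)"
    by (simp add: power2_eq_square algebra_simps)
  also have "\<dots> \<le> (t + sum_mset (add_mset p M) - a)\<^sup>2 + sum_mset (add_mset p M)"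
    using add.prems by (simp add: algebra_simps)
  finally show ?case .
qed simp

text \<open>A converse of \<open>berns_jensen\<close>. The Lipschitz bound leaves a mean absolute
  deviation, which AM-GM trades for a second moment. The free \<open>c\<close> stands in for the
  square root of the mean, so that the error is linear in the mean and can be charged against
  revenue.\<close>

lemma berns_le_mean:
  assumes "icx \<phi>" "prob_mset M" "0 < c"
  shows "berns M \<phi> t \<le> \<phi> (t + sum_mset M) + sum_mset M / (2 * c) + c / 2"
proof -
  let ?a = "t + sum_mset M"
  have "\<phi> s \<le> 1 / (2 * c) * (s - ?a)\<^sup>2 + 1 * (\<phi> ?a + c / 2)" for s
  proof -
    have "\<phi> s \<le> \<phi> ?a + \<bar>s - ?a\<bar>"
    proof (cases "?a \<le> s")
      case True
      with assms(1) have "\<phi> s - \<phi> ?a \<le> s - ?a" unfolding icx_def by blast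
      with True show ?thesis by linarith
    next
      case False
      with assms(1) have "\<phi> s \<le> \<phi> ?a" unfolding icx_def by (auto simp: mono_def)
      then show ?thesis by linarith
    qed
    moreover have "\<bar>s - ?a\<bar> \<le> 1 / (2 * c) * (s - ?a)\<^sup>2 + c / 2"
    proof -
      have "0 \<le> (\<bar>s - ?a\<bar> - c)\<^sup>2" by simp
      then have "2 * c * \<bar>s - ?a\<bar> \<le> (s - ?a)\<^sup>2 + c * c"
        by (simp add: power2_diff power2_abs) (simp add: power2_eq_square algebra_simps)
      with assms(3) show ?thesis by (simp add: field_simps)
    qed
    ultimately show ?thesis by simp
  qed
  then have "berns M \<phi> t \<le> berns M (\<lambda>s. 1 / (2 * c) * (s - ?a)\<^sup>2 + 1 * (\<phi> ?a + c / 2)) t"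
    by (intro berns_mono[OF assms(2)])
  also have "\<dots> = 1 / (2 * c) * berns M (\<lambda>s. (s - ?a)\<^sup>2) t + (\<phi> ?a + c / 2)"
    unfolding berns_linear by simp
  also have "\<dots> \<le> 1 / (2 * c) * (0 + sum_mset M) + (\<phi> ?a + c / 2)"
    using berns_square_le[OF assms(2), of ?a t] assms(3) by (intro add_mono mult_left_mono) auto
  finally show ?thesis by (simp add: field_simps)
qed

section \<open>Expected excess over the capacity and its increments\<close>

definition excess :: "nat \<Rightarrow> real \<Rightarrow> real" where
  "excess B t = max 0 (t - real B)"

text \<open>At integers \<open>t\<close> this is the indicator of \<open>t \<ge> B\<close>.\<close>

definition overflow :: "nat \<Rightarrow> real \<Rightarrow> real" where
  "overflow B t = excess B (t + 1) - excess B t"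

lemma icx_excess: "icx (excess B)"
proof -
  have "convex_on UNIV (excess B)"
  proof (rule convex_onI)
    fix t x y :: real assume t: "0 < t" "t < 1"
    have "(1 - t) * (x - real B) \<le> (1 - t) * excess B x" "t * (y - real B) \<le> t * excess B y"
      using t by (auto simp: excess_def intro!: mult_left_mono)
    moreover have "0 \<le> (1 - t) * excess B x" "0 \<le> t * excess B y"
      using t by (auto simp: excess_def)
    moreover have "(1 - t) *\<^sub>R x + t *\<^sub>R y - real B = (1 - t) * (x - real B) + t * (y - real B)"
      by (simp add: algebra_simps)
    ultimately show "excess B ((1 - t) *\<^sub>R x + t *\<^sub>R y) \<le> (1 - t) * excess B x + t * excess B y"
      unfolding excess_def[of B "_ + _"] by simp
  qed simp
  then show ?thesis by (auto simp: icx_def mono_def excess_def)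
qed

lemma overflow_mono: "mono (overflow B)" and overflow_nonneg: "0 \<le> overflow B t"
  and overflow_le: "overflow B t \<le> 1"
  by (auto simp: overflow_def excess_def mono_def max_def)

lemma berns_add_one:
  "berns (add_mset p M) (excess B) t = berns M (excess B) t + p * berns M (overflow B) t"
proof -
  have "bern p (excess B) = (\<lambda>t. 1 * excess B t + p * overflow B t)"
    by (auto simp: bern_def overflow_def algebra_simps)
  then show ?thesis using berns_linear[of M 1 "excess B" p "overflow B" t] by (simp add: berns_add_mset')
qed

lemma berns_overflow_mono: 
  assumes "prob_mset M" "prob_mset N"
  shows "berns M (overflow B) t \<le> berns (N + M) (overflow B) t"
  using assms by (simp add: berns_union berns_ge mono_berns overflow_mono)

text \<open>Add the elements of \<open>N\<close> one at a time: each costs its parameter times the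
  overflow probability at that moment, which only grows. Its initial value gives this bound, its
  final value gives \<open>berns_excess_le\<close>.\<close>

lemma berns_excess_ge:
  assumes "prob_mset M" "prob_mset N"
  shows "berns M (excess B) t + sum_mset N * berns M (overflow B) t \<le> berns (N + M) (excess B) t"
  using assms(2)
proof (induction N)
  case (add p N)
  have "berns M (overflow B) t \<le> berns (N + M) (overflow B) t"
    using add assms by (intro berns_overflow_mono) auto
  then have "p * berns M (overflow B) t \<le> p * berns (N + M) (overflow B) t"
    using add.prems by (intro mult_left_mono) auto
  then show ?case using add by (simp add: berns_add_one algebra_simps)
qed simp

lemma berns_excess_le:
  assumes "prob_mset M" "prob_mset N"
  shows "berns (N + M) (excess B) t \<le> berns M (excess B) t + sum_mset N * berns (N + M) (overflow B) t"
  using assms(2)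
proof (induction N)
  case (add p N)
  have le: "berns (N + M) (overflow B) t \<le> berns ({#p#} + (N + M)) (overflow B) t"
    using add assms by (intro berns_overflow_mono) auto
  then have "p * berns (N + M) (overflow B) t \<le> p * berns (add_mset p (N + M)) (overflow B) t"
    using add.prems by (intro mult_left_mono) auto
  moreover have "sum_mset N * berns (N + M) (overflow B) t
      \<le> sum_mset N * berns (add_mset p (N + M)) (overflow B) t"
    using add.prems le by (intro mult_left_mono sum_mset_prob_nonneg) auto
  ultimately show ?case using add by (simp add: berns_add_one algebra_simps)
qed simp

lemma berns_exp: "berns M (\<lambda>s. exp (- \<theta> * s)) t = exp (- \<theta> * t) * (\<Prod>p\<in>#M. 1 - p + p * exp (- \<theta>))"
proof (induction M arbitrary: t)
  case (add p M)
  have "exp (- \<theta> * (t + 1)) = exp (- \<theta> * t) * exp (- \<theta>)"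
    by (simp add: algebra_simps flip: exp_add)
  then show ?case
    using add.IH by (simp add: berns_add_mset bern_def algebra_simps)
qed simp

lemma exp_minus_le: 
  fixes \<theta> :: real
  assumes "0 \<le> \<theta>" "\<theta> \<le> 1"
  shows "exp (- \<theta>) \<le> 1 - \<theta> / 2"
proof -
  have "exp (- \<theta>) * (1 + \<theta>) \<le> exp (- \<theta>) * exp \<theta>"
    by (intro mult_left_mono) auto
  also have "\<dots> = 1" by (simp flip: exp_add)
  also have "1 \<le> (1 - \<theta> / 2) * (1 + \<theta>)"
    using assms mult_left_le[of \<theta> \<theta>] by (simp add: algebra_simps)
  finally show ?thesis using assms by (simp add: mult_le_cancel_right)
qed

text \<open>If the \<open>b\<close> variables sum to at least \<open>D\<close>, monotonicity of
  \<open>overflow\<close> suffices; the opposite event is a lower tail, whose indicator is dominated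
  by an exponential. Only half of the mean \<open>p * b\<close> appears because of the crude
  \<open>exp_minus_le\<close>.\<close>

lemma berns_replicate_overflow_ge:
  assumes "0 \<le> p" "p \<le> 1" "0 \<le> \<theta>" "\<theta> \<le> 1"
  shows "overflow B (t + D) - exp (\<theta> * (D - p * real b / 2)) \<le> berns (replicate_mset b p) (overflow B) t"
proof -
  have P: "prob_mset (replicate_mset b p)" using assms by simp
  have pt: "1 * overflow B (t + D) - exp (\<theta> * (D + t)) * exp (- \<theta> * s) \<le> overflow B s" for s
  proof (cases "t + D \<le> s")
    case True
    then have "overflow B (t + D) \<le> overflow B s" using overflow_mono by (auto simp: mono_def)
    moreover have "0 \<le> exp (\<theta> * (D + t)) * exp (- \<theta> * s)" by simp
    ultimately show ?thesis by linarith
  next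
    case False
    have "0 \<le> \<theta> * (D + t - s)" using False assms by (intro mult_nonneg_nonneg) auto
    then have "1 \<le> exp (\<theta> * (D + t)) * exp (- \<theta> * s)"
      by (simp add: algebra_simps flip: exp_add)
    then show ?thesis using overflow_le[of B "t + D"] overflow_nonneg[of B s] by linarith
  qed
  have "(1 - p + p * exp (- \<theta>)) \<le> exp (- \<theta> * p / 2)"
  proof -
    have "p * exp (- \<theta>) \<le> p * (1 - \<theta> / 2)"
      using assms exp_minus_le by (intro mult_left_mono) auto
    then have "1 - p + p * exp (- \<theta>) \<le> 1 + (- \<theta> * p / 2)" by (simp add: algebra_simps)
    also have "\<dots> \<le> exp (- \<theta> * p / 2)" by (rule exp_ge_add_one_self)
    finally show ?thesis .
  qed
  then have "(1 - p + p * exp (- \<theta>)) ^ b \<le> exp (- \<theta> * p / 2) ^ b"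
    using assms by (intro power_mono) auto
  also have "\<dots> = exp (- \<theta> * p / 2 * real b)" by (simp flip: exp_of_nat2_mult)
  finally have "exp (\<theta> * D) * (1 - p + p * exp (- \<theta>)) ^ b \<le> exp (\<theta> * D) * exp (- \<theta> * p / 2 * real b)"
    by (intro mult_left_mono) auto
  also have "\<dots> = exp (\<theta> * (D - p * real b / 2))" by (simp add: algebra_simps flip: exp_add)
  finally have le: "exp (\<theta> * D) * (1 - p + p * exp (- \<theta>)) ^ b \<le> exp (\<theta> * (D - p * real b / 2))" .
  have "berns (replicate_mset b p) (\<lambda>s. overflow B (t + D) - exp (\<theta> * (D + t)) * exp (- \<theta> * s)) t
     = overflow B (t + D) - exp (\<theta> * (D + t)) * (exp (- \<theta> * t) * (1 - p + p * exp (- \<theta>)) ^ b)"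
    using berns_linear[of "replicate_mset b p" 1 "\<lambda>_. overflow B (t + D)" "- exp (\<theta> * (D + t))" "\<lambda>s. exp (- \<theta> * s)" t]
    using berns_exp[of "replicate_mset b p" \<theta> t] by simp
  also have "exp (\<theta> * (D + t)) * (exp (- \<theta> * t) * (1 - p + p * exp (- \<theta>)) ^ b) 
      = exp (\<theta> * D) * (1 - p + p * exp (- \<theta>)) ^ b"
    by (simp add: algebra_simps flip: exp_add mult.assoc)
  finally have "overflow B (t + D) - exp (\<theta> * (D - p * real b / 2))
     \<le> berns (replicate_mset b p) (\<lambda>s. overflow B (t + D) - exp (\<theta> * (D + t)) * exp (- \<theta> * s)) t"
    using le by simp
  also have "\<dots> \<le> berns (replicate_mset b p) (overflow B) t"
    using pt by (intro berns_mono[OF P]) simp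
  finally show ?thesis .
qed

section \<open>Accepted customers as multisets of Bernoulli parameters\<close>

definition show_mset :: "(nat \<Rightarrow> real) \<Rightarrow> nat set \<Rightarrow> (nat \<Rightarrow> nat) \<Rightarrow> real multiset" where
  "show_mset p J x = (\<Sum>j\<in>J. replicate_mset (x j) (p j))"

lemma show_mset_add: "show_mset p J (\<lambda>j. x j + y j) = show_mset p J x + show_mset p J y"
  by (induction J rule: infinite_finite_induct)
     (auto simp: show_mset_def multiset_eq_iff)

lemma show_mset_cong: "(\<And>j. j \<in> J \<Longrightarrow> x j = y j) \<Longrightarrow> show_mset p J x = show_mset p J y"
  by (simp add: show_mset_def)

lemma show_mset_Diff:
  "finite J \<Longrightarrow> I \<subseteq> J \<Longrightarrow> show_mset p J x = show_mset p I x + show_mset p (J - I) x"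
  unfolding show_mset_def by (subst sum.subset_diff[of I J]) (auto simp: add_ac)

lemma show_mset_single:
  assumes "finite J" "j \<in> J"
  shows "show_mset p J (\<lambda>i. if i = j then m else 0) = replicate_mset m (p j)"
proof -
  have "show_mset p J (\<lambda>i. if i = j then m else 0) = (\<Sum>i\<in>J. if i = j then replicate_mset m (p j) else {#})"
    unfolding show_mset_def by (intro sum.cong) auto
  then show ?thesis using assms by simp
qed

lemma in_show_mset: "finite J \<Longrightarrow> a \<in># show_mset p J x \<Longrightarrow> \<exists>j\<in>J. 0 < x j \<and> a = p j"
  by (induction J rule: finite_induct) (auto simp: show_mset_def split: if_splits)

lemma sum_mset_show_mset: "sum_mset (show_mset p J x) = (\<Sum>j\<in>J. p j * real (x j))"
  by (induction J rule: infinite_finite_induct) (auto simp: show_mset_def)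

lemma size_show_mset: "size (show_mset p J x) = (\<Sum>j\<in>J. x j)"
  by (induction J rule: infinite_finite_induct) (auto simp: show_mset_def)

lemma expectation_bind_finite:
  fixes h :: "'b \<Rightarrow> real"
  assumes "finite (set_pmf M)" "\<And>x. x \<in> set_pmf M \<Longrightarrow> finite (set_pmf (f x))"
  shows "measure_pmf.expectation (M \<bind> f) h = measure_pmf.expectation M (\<lambda>a. measure_pmf.expectation (f a) h)"
  using assms by (subst pmf_expectation_bind[of "set_pmf M"])
    (auto simp: integral_measure_pmf_real[of "set_pmf M"] mult.commute)

lemma expectation_binomial_berns:
  assumes "0 \<le> p" "p \<le> 1"
  shows "measure_pmf.expectation (binomial_pmf n p) (\<lambda>m. \<phi> (t + real m)) = berns (replicate_mset n p) \<phi> t"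
proof (induction n arbitrary: t)
  case 0
  then show ?case using assms by (simp add: binomial_pmf_0)
next
  case (Suc n)
  have fin: "finite (set_pmf (binomial_pmf m p))" for m using assms by auto
  have "measure_pmf.expectation (binomial_pmf (Suc n) p) (\<lambda>m. \<phi> (t + real m)) =
    measure_pmf.expectation (bernoulli_pmf p) (\<lambda>b. measure_pmf.expectation (binomial_pmf n p)
      (\<lambda>m. \<phi> (t + real ((if b then 1 else 0) + m))))"
    using assms by (simp add: binomial_pmf_Suc expectation_bind_finite fin)
  also have "\<dots> = (1 - p) * measure_pmf.expectation (binomial_pmf n p) (\<lambda>m. \<phi> (t + real m)) +
     p * measure_pmf.expectation (binomial_pmf n p) (\<lambda>m. \<phi> ((t + 1) + real m))"
    using assms by (simp add: add_ac)
  also have "\<dots> = berns (replicate_mset (Suc n) p) \<phi> t"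
    unfolding Suc.IH by (simp add: berns_add_mset bern_def)
  finally show ?case .
qed

lemma expectation_Pi_binomial_berns:
  assumes "finite J" "\<And>j. j \<in> J \<Longrightarrow> 0 \<le> p j \<and> p j \<le> 1"
  shows "measure_pmf.expectation (Pi_pmf J 0 (\<lambda>j. binomial_pmf (x j) (p j)))
      (\<lambda>X. \<phi> (t + (\<Sum>j\<in>J. real (X j)))) = berns (show_mset p J x) \<phi> t"
  using assms
proof (induction J arbitrary: t rule: finite_induct)
  case empty
  then show ?case by (simp add: show_mset_def)
next
  case (insert i J)
  have fin: "finite (set_pmf (binomial_pmf (x j) (p j)))" if "j \<in> insert i J" for j
    using insert.prems that by auto
  have fin': "finite (set_pmf (Pi_pmf J 0 (\<lambda>j. binomial_pmf (x j) (p j))))"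
    using insert fin by (auto simp: set_Pi_pmf)
  have *: "(\<Sum>j\<in>J. real (if j = i then a else X j)) = (\<Sum>j\<in>J. real (X j))" for a X
    using insert.hyps by (intro sum.cong) auto
  have "measure_pmf.expectation (Pi_pmf (insert i J) 0 (\<lambda>j. binomial_pmf (x j) (p j)))
      (\<lambda>X. \<phi> (t + (\<Sum>j\<in>insert i J. real (X j)))) =
     measure_pmf.expectation (binomial_pmf (x i) (p i)) (\<lambda>a.
       measure_pmf.expectation (Pi_pmf J 0 (\<lambda>j. binomial_pmf (x j) (p j)))
      (\<lambda>X. \<phi> ((t + real a) + (\<Sum>j\<in>J. real (X j)))))"
    using insert.hyps by (simp add: Pi_pmf_insert' expectation_bind_finite fin fin' * add_ac)
  also have "\<dots> = measure_pmf.expectation (binomial_pmf (x i) (p i))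
      (\<lambda>a. berns (show_mset p J x) \<phi> (t + real a))"
    using insert by simp
  also have "\<dots> = berns (replicate_mset (x i) (p i)) (berns (show_mset p J x) \<phi>) t"
    using insert.prems by (intro expectation_binomial_berns) auto
  finally show ?case using insert.hyps by (simp add: show_mset_def berns_union)
qed

section \<open>Exponential moments of bounded variables\<close>

lemma exp_le_quadratic:
  fixes x :: real
  assumes "\<bar>x\<bar> \<le> 1"
  shows "exp x \<le> 1 + x + x\<^sup>2"
proof (cases "0 \<le> x")
  case True
  then show ?thesis using assms by (intro exp_bound) auto
next
  case False
  define y where "y = - x"
  have y: "0 \<le> y" using False by (simp add: y_def)
  have pos: "0 < 1 - y + y\<^sup>2"
  proof -
    have "0 \<le> (y - 1 / 2)\<^sup>2" by simp
    then show ?thesis by (simp add: power2_eq_square algebra_simps)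
  qed
  have "exp (- y) * (1 + y + y\<^sup>2 / 2) \<le> exp (- y) * exp y"
    using exp_lower_Taylor_quadratic[OF y] by (intro mult_left_mono) auto
  also have "\<dots> = 1" by (simp flip: exp_add)
  \<comment> \<open>For negative arguments the claim is the lower Taylor bound of
    \<open>exp y\<close> inverted; this product exceeds 1 by nonnegative powers of
    \<open>y\<close>.\<close>
  also have "1 \<le> (1 - y + y\<^sup>2) * (1 + y + y\<^sup>2 / 2)"
  proof -
    have "(1 - y + y\<^sup>2) * (1 + y + y\<^sup>2 / 2) = 1 + (y^2 + y^3 + y^4) / 2"
      by (simp add: field_simps power2_eq_square power3_eq_cube power4_eq_xxxx)
    then show ?thesis using y by simp
  qed
  finally have "exp (- y) * (1 + y + y\<^sup>2 / 2) \<le> (1 - y + y\<^sup>2) * (1 + y + y\<^sup>2 / 2)" .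
  moreover have "0 < 1 + y + y\<^sup>2 / 2" using y by (intro add_pos_nonneg) auto
  ultimately have "exp (- y) \<le> 1 - y + y\<^sup>2" by (simp only: mult_le_cancel_right_pos)
  then show ?thesis by (simp add: y_def)
qed

text \<open>Second-order expansion under the expectation, then \<open>1 + u \<le> exp u\<close>. The
  range 2 leaves room for the signs shifted by \<open>p j / 4\<close> in
  \<open>sign_mgf_le\<close>.\<close>

lemma mgf_le:
  fixes \<theta> :: real
  assumes "\<And>j. j \<in> K \<Longrightarrow> 0 \<le> w j" "(\<Sum>j\<in>K. w j) = 1"
    and X: "\<And>j. j \<in> K \<Longrightarrow> \<bar>X j\<bar> \<le> 2" and \<theta>: "0 \<le> \<theta>" "\<theta> \<le> 1 / 2"
  shows "(\<Sum>j\<in>K. w j * exp (\<theta> * X j)) \<le> exp (\<theta> * (\<Sum>j\<in>K. w j * X j) + 4 * \<theta>\<^sup>2)"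
proof -
  have "(\<Sum>j\<in>K. w j * exp (\<theta> * X j)) \<le> (\<Sum>j\<in>K. w j * (1 + \<theta> * X j + 4 * \<theta>\<^sup>2))"
  proof (intro sum_mono mult_left_mono assms(1))
    fix j assume j: "j \<in> K"
    have "\<bar>\<theta> * X j\<bar> \<le> 1 / 2 * 2"
      unfolding abs_mult using X[OF j] \<theta> by (intro mult_mono) auto
    then have "exp (\<theta> * X j) \<le> 1 + \<theta> * X j + (\<theta> * X j)\<^sup>2" by (intro exp_le_quadratic) simp
    also have "(\<theta> * X j)\<^sup>2 \<le> 4 * \<theta>\<^sup>2"
    proof -
      have "(X j)\<^sup>2 \<le> 2\<^sup>2" using X[OF j] abs_le_square_iff[of "X j" 2] by simp
      then have "\<theta>\<^sup>2 * (X j)\<^sup>2 \<le> \<theta>\<^sup>2 * 4" by (intro mult_left_mono) auto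
      then show ?thesis by (simp add: power_mult_distrib mult.commute)
    qed
    finally show "exp (\<theta> * X j) \<le> 1 + \<theta> * X j + 4 * \<theta>\<^sup>2" by simp
  qed
  also have "\<dots> = (\<Sum>j\<in>K. w j * (1 + 4 * \<theta>\<^sup>2) + \<theta> * (w j * X j))"
    by (intro sum.cong) (auto simp: algebra_simps)
  also have "\<dots> = 1 + (\<theta> * (\<Sum>j\<in>K. w j * X j) + 4 * \<theta>\<^sup>2)"
    unfolding sum.distrib sum_distrib_right[symmetric] sum_distrib_left[symmetric] assms(2) by simp
  also have "\<dots> \<le> exp (\<theta> * (\<Sum>j\<in>K. w j * X j) + 4 * \<theta>\<^sup>2)" by (rule exp_ge_add_one_self)
  finally show ?thesis .
qed

lemma sum_arrival_count:
  assumes "finite K" "\<forall>u\<in>{s..T}. A u \<in> K"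
  shows "(\<Sum>i\<in>K. c i * real (arrival_count A s T i)) = (\<Sum>u\<in>{s..T}. c (A u))"
proof -
  have "(\<Sum>i\<in>K. c i * real (arrival_count A s T i)) = (\<Sum>i\<in>K. \<Sum>u\<in>{u \<in> {s..T}. A u = i}. c (A u))"
    by (intro sum.cong) (auto simp: arrival_count_def)
  also have "\<dots> = (\<Sum>u\<in>{s..T}. c (A u))"
    using assms by (intro sum.group) auto
  finally show ?thesis .
qed

text \<open>Signs that linearize an l1 distance: with \<open>S\<close> the coordinates where
  \<open>m' i \<le> m i\<close>, the sum of \<open>plus_minus S i * (m i - m' i)\<close> is the sum
  of the absolute differences.\<close>

definition plus_minus :: "nat set \<Rightarrow> nat \<Rightarrow> real" where
  "plus_minus S i = (if i \<in> S then 1 else - 1)"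

section \<open>The model in terms of Bernoulli sums\<close>

locale overbooking =
  fixes k :: nat and lam v p :: "nat \<Rightarrow> real"
  assumes valid: "valid_params k lam v p"
begin

lemma p_bounds: "j \<in> {1..k} \<Longrightarrow> 0 < p j \<and> p j \<le> 1"
  and v_nonneg: "j \<in> {1..k} \<Longrightarrow> 0 \<le> v j"
  and lam_pos: "j \<in> {1..k} \<Longrightarrow> 0 < lam j"
  and lam_sum: "(\<Sum>j\<in>{1..k}. lam j) = 1"
  using valid by (auto simp: valid_params_def)

definition q :: "nat \<Rightarrow> real" where "q j = v j / p j"

lemma q_bounds: "j \<in> {1..k} \<Longrightarrow> 0 \<le> q j \<and> q j < 1"
proof
  assume j: "j \<in> {1..k}"
  then show "0 \<le> q j" using p_bounds[of j] v_nonneg[of j] by (simp add: q_def)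
  show "q j < 1" using valid j unfolding valid_params_def q_def by blast
qed

lemma p_nonneg: "j \<in> {1..k} \<Longrightarrow> 0 \<le> p j"
  using p_bounds[of j] by simp

lemma v_eq: "j \<in> {1..k} \<Longrightarrow> v j = q j * p j"
  using p_bounds[of j] by (simp add: q_def)

text \<open>Among equal ratios the earlier type has the larger show-up probability; this is the
  direction that \<open>berns_majorization\<close> needs to favour it.\<close>

lemma q_antimono_ties:
  assumes "1 \<le> i" "i \<le> j" "j \<le> k"
  shows "q j \<le> q i \<and> (q j = q i \<longrightarrow> p j \<le> p i)"
  using assms(2,3)
proof (induction j rule: dec_induct)
  case (step j)
  then have "j \<in> {1..<k}" using assms by auto
  then have "q (j + 1) \<le> q j \<and> (q j = q (j + 1) \<longrightarrow> p (j + 1) < p j)"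
    using valid unfolding valid_params_def q_def by blast
  then show ?case using step by auto
qed simp

lemma k_pos: "1 \<le> k"
  using lam_sum by (cases k) auto

abbreviation all_shows :: "(nat \<Rightarrow> nat) \<Rightarrow> real multiset" where
  "all_shows \<equiv> show_mset p {1..k}"

lemma prob_show_mset: "J \<subseteq> {1..k} \<Longrightarrow> prob_mset (show_mset p J x)"
proof -
  assume J: "J \<subseteq> {1..k}"
  then have "finite J" using finite_subset by blast
  show ?thesis
    unfolding prob_mset_def
  proof
    fix a assume "a \<in># show_mset p J x"
    then obtain j where "j \<in> J" "a = p j" using in_show_mset[OF \<open>finite J\<close>] by blast
    then show "0 \<le> a \<and> a \<le> 1" using J p_nonneg[of j] p_bounds[of j] by blast
  qed
qed

lemma objective_eq:
  "objective k v p B x = (\<Sum>j\<in>{1..k}. v j * real (x j)) - berns (all_shows x) (excess B) 0"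
proof -
  have "measure_pmf.expectation (Pi_pmf {1..k} 0 (\<lambda>j. binomial_pmf (x j) (p j)))
      (\<lambda>X. excess B (0 + (\<Sum>j\<in>{1..k}. real (X j)))) = berns (all_shows x) (excess B) 0"
  proof (rule expectation_Pi_binomial_berns)
    show "0 \<le> p j \<and> p j \<le> 1" if "j \<in> {1..k}" for j using p_bounds[OF that] by simp
  qed simp
  then have "berns (all_shows x) (excess B) 0 = compensation k p B x"
    by (simp only: compensation_def excess_def add_0)
  then show ?thesis by (simp add: objective_def)
qed

subsection \<open>Near-optimality of index solutions\<close>

lemma ratio_gap: "\<exists>\<delta>>0. \<forall>i\<in>{1..k}. \<forall>j\<in>{1..k}. q i \<noteq> q j \<longrightarrow> \<delta> \<le> \<bar>q i - q j\<bar>"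
proof -
  \<comment> \<open>The element 1 keeps the set nonempty when all ratios coincide.\<close>
  let ?S = "insert 1 ((\<lambda>(i, j). \<bar>q i - q j\<bar>) ` {(i, j) \<in> {1..k} \<times> {1..k}. q i \<noteq> q j})"
  have "finite {(i, j) \<in> {1..k} \<times> {1..k}. q i \<noteq> q j}"
    by (rule finite_subset[of _ "{1..k} \<times> {1..k}"]) auto
  then have fin: "finite ?S" by simp
  have "0 < Min ?S" using fin by (subst Min_gr_iff) auto
  moreover have "Min ?S \<le> \<bar>q i - q j\<bar>" if "i \<in> {1..k}" "j \<in> {1..k}" "q i \<noteq> q j" for i j
    using that by (intro Min_le[OF fin]) auto
  ultimately show ?thesis by blast
qed

text \<open>The greedy prefix with the largest expected number of show-ups not exceeding that of \<open>x\<close>.\<close>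

lemma fluid_index_solution:
  assumes "\<forall>j\<in>{1..k}. x j \<le> n j"
  obtains j0 x' where "j0 \<in> {1..k}" "index_solution k n x'"
    "\<And>j. j \<in> {1..k} \<Longrightarrow> j < j0 \<Longrightarrow> x' j = n j" "\<And>j. j \<in> {1..k} \<Longrightarrow> j0 < j \<Longrightarrow> x' j = 0"
    "(\<Sum>j\<in>{1..k}. p j * real (x' j)) \<le> (\<Sum>j\<in>{1..k}. p j * real (x j))"
    "(\<Sum>j\<in>{1..k}. p j * real (x j)) - 1 \<le> (\<Sum>j\<in>{1..k}. p j * real (x' j))"
proof -
  define \<mu> where "\<mu> = (\<Sum>j\<in>{1..k}. p j * real (x j))"
  define P where "P j \<longleftrightarrow> j \<in> {1..k} \<and> \<mu> \<le> (\<Sum>i\<in>{1..j}. p i * real (n i))" for j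
  have "P k" unfolding P_def \<mu>_def
    using k_pos assms p_nonneg by (auto intro!: sum_mono mult_left_mono)
  define j0 where "j0 = (LEAST j. P j)"
  have Pj0: "P j0" unfolding j0_def using \<open>P k\<close> by (rule LeastI)
  then have j0: "j0 \<in> {1..k}" by (simp add: P_def)
  define L where "L = (\<Sum>i\<in>{1..<j0}. p i * real (n i))"
  have L: "L \<le> \<mu>"
  proof (cases "j0 = 1")
    case True
    then show ?thesis unfolding L_def \<mu>_def using p_nonneg by (auto intro!: sum_nonneg)
  next
    case False
    then have "\<not> P (j0 - 1)" using j0 unfolding j0_def by (intro not_less_Least) auto
    moreover have "{1..j0 - 1} = {1..<j0}" using j0 by auto
    ultimately show ?thesis using j0 False by (auto simp: P_def L_def)
  qed
  have pj0: "0 < p j0" "p j0 \<le> 1" using p_bounds[OF j0] by auto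
  \<comment> \<open>The fractional number of type \<open>j0\<close> customers that would match the
    mean exactly; rounding it down loses at most \<open>p j0 \<le> 1\<close>.\<close>
  define r where "r = (\<mu> - L) / p j0"
  have r0: "0 \<le> r" using L pj0 by (simp add: r_def)
  have pr: "p j0 * r = \<mu> - L" using pj0 by (simp add: r_def)
  have "{1..j0} = insert j0 {1..<j0}" using j0 by auto
  then have "\<mu> \<le> p j0 * real (n j0) + L" using Pj0 by (simp add: P_def L_def)
  then have rn: "r \<le> real (n j0)" using pj0 by (simp add: r_def field_simps)
  define m where "m = nat \<lfloor>r\<rfloor>"
  have mr: "real m \<le> r" "r - 1 \<le> real m" using r0 unfolding m_def by linarith+
  have mn: "m \<le> n j0" using mr(1) rn by linarith
  define x' where "x' = (\<lambda>j\<in>{1..k}. if j < j0 then n j else if j = j0 then m else 0)"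
  have "(\<Sum>j\<in>{1..k}. p j * real (x' j)) = (\<Sum>j\<in>insert j0 {1..<j0}. p j * real (x' j))"
    using j0 by (intro sum.mono_neutral_right) (auto simp: x'_def)
  also have "\<dots> = p j0 * real m + (\<Sum>j\<in>{1..<j0}. p j * real (x' j))"
    using j0 by (subst sum.insert) (auto simp: x'_def)
  also have "(\<Sum>j\<in>{1..<j0}. p j * real (x' j)) = L"
    unfolding L_def using j0 by (intro sum.cong) (auto simp: x'_def)
  finally have mean: "(\<Sum>j\<in>{1..k}. p j * real (x' j)) = p j0 * real m + L" .
  have "p j0 * real m \<le> p j0 * r" "p j0 * (r - 1) \<le> p j0 * real m"
    using mr pj0 by (auto intro: mult_left_mono)
  then have le: "p j0 * real m + L \<le> \<mu>" and ge: "\<mu> - 1 \<le> p j0 * real m + L"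
    using pr pj0 by (auto simp: right_diff_distrib)
  show ?thesis
  proof (rule that[OF j0, of x'])
    show "index_solution k n x'"
      unfolding index_solution_def offline_feasible_def
    proof (intro conjI bexI[of _ j0] ballI PiE_I)
      fix j assume "j \<in> {1..k}"
      then show "x' j \<in> {0..n j}" using mn by (simp add: x'_def)
    qed (use j0 in \<open>auto simp: x'_def\<close>)
    show "(\<Sum>j\<in>{1..k}. p j * real (x' j)) \<le> (\<Sum>j\<in>{1..k}. p j * real (x j))"
      "(\<Sum>j\<in>{1..k}. p j * real (x j)) - 1 \<le> (\<Sum>j\<in>{1..k}. p j * real (x' j))"
      using le ge unfolding mean \<mu>_def by auto
  qed (simp_all add: x'_def)
qed

text \<open>Compare \<open>x\<close> with the index solution \<open>x'\<close> of the same mean. Moving mean \<open>D\<close> between types whose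
  ratio differs from that of the threshold type gains \<open>\<delta> D\<close> in revenue, while the compensation increases
  by at most a square-root amount, linearized here as \<open>D / (2 c) + c / 2\<close>. Exchanges among types of equal
  ratio replace small show-up probabilities by larger ones, which majorization allows for free.\<close>

lemma index_gap:
  obtains C where "\<And>B n x. \<forall>j\<in>{1..k}. x j \<le> n j \<Longrightarrow>
    \<exists>x'. index_solution k n x' \<and> objective k v p B x \<le> objective k v p B x' + C"
proof -
  obtain \<delta> where \<delta>: "0 < \<delta>" "\<And>i j. i \<in> {1..k} \<Longrightarrow> j \<in> {1..k} \<Longrightarrow> q i \<noteq> q j \<Longrightarrow> \<delta> \<le> \<bar>q i - q j\<bar>"
    using ratio_gap by blast
  \<comment> \<open>With this \<open>c\<close> the compensation error \<open>D / (2 * c)\<close> is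
    half of the revenue gain \<open>\<delta> * D\<close>.\<close>
  define c where "c = 1 / \<delta>"
  have c: "0 < c" using \<delta> by (simp add: c_def)
  \<comment> \<open>In the constant, 3 is one unit for the missing mean and one for each of the
    roundings \<open>N1\<close> and \<open>N2\<close>; 1 / \<delta> is twice \<open>c / 2\<close>;
    \<delta> / 2 is \<open>1 / (2 * c)\<close>, caused by rounding \<open>N2\<close> up.\<close>
  have "\<exists>x'. index_solution k n x' \<and> objective k v p B x \<le> objective k v p B x' + (3 + 1 / \<delta> + \<delta> / 2)"
    if xn: "\<forall>j\<in>{1..k}. x j \<le> n j" for B n x
  proof -
    let ?K = "{1..k}"
    obtain j0 x' where j0: "j0 \<in> ?K" and ind: "index_solution k n x'"
      and lo: "\<And>j. j \<in> ?K \<Longrightarrow> j < j0 \<Longrightarrow> x' j = n j" and hi: "\<And>j. j \<in> ?K \<Longrightarrow> j0 < j \<Longrightarrow> x' j = 0"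
      and mean: "(\<Sum>j\<in>?K. p j * real (x' j)) \<le> (\<Sum>j\<in>?K. p j * real (x j))"
        "(\<Sum>j\<in>?K. p j * real (x j)) - 1 \<le> (\<Sum>j\<in>?K. p j * real (x' j))"
      by (rule fluid_index_solution[OF xn]) (rule that; assumption)
    define \<pi> where "\<pi> = p j0"
    have \<pi>: "0 < \<pi>" "\<pi> \<le> 1" using p_bounds[OF j0] by (auto simp: \<pi>_def)
    define G where "G = {j \<in> ?K. q j = q j0}"
    define H where "H = ?K - G"
    have GK: "G \<subseteq> ?K" and HK: "H \<subseteq> ?K" by (auto simp: G_def H_def)
    have fin: "finite G" "finite H" using GK HK finite_subset by blast+
    define d where "d j = p j * (real (x' j) - real (x j))" for j
    define D where "D = (\<Sum>j\<in>H. \<bar>d j\<bar>)"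
    have D0: "0 \<le> D" by (simp add: D_def sum_nonneg)
    have sd: "(\<Sum>j\<in>?K. d j) = (\<Sum>j\<in>?K. p j * real (x' j)) - (\<Sum>j\<in>?K. p j * real (x j))"
      by (simp add: d_def right_diff_distrib sum_subtractf)

    have "(\<Sum>j\<in>?K. v j * real (x' j)) - (\<Sum>j\<in>?K. v j * real (x j)) = (\<Sum>j\<in>?K. q j * d j)"
      unfolding sum_subtractf[symmetric] by (intro sum.cong) (auto simp: v_eq d_def algebra_simps)
    also have "\<dots> = (\<Sum>j\<in>?K. (q j - q j0) * d j) + q j0 * (\<Sum>j\<in>?K. d j)"
      by (simp add: sum_distrib_left left_diff_distrib sum_subtractf)
    finally have rev: "(\<Sum>j\<in>?K. v j * real (x' j)) - (\<Sum>j\<in>?K. v j * real (x j))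
        = (\<Sum>j\<in>?K. (q j - q j0) * d j) + q j0 * (\<Sum>j\<in>?K. d j)" .
    have "q j0 * (\<Sum>j\<in>?K. d j) \<ge> - 1"
    proof -
      have "q j0 * - (\<Sum>j\<in>?K. d j) \<le> 1 * 1"
        using q_bounds[OF j0] mean sd by (intro mult_mono) auto
      then show ?thesis by simp
    qed
    moreover have "(\<Sum>j\<in>?K. (q j - q j0) * d j) \<ge> \<delta> * D"
    proof -
      have "?K \<inter> H = H" using HK by blast
      then have "\<delta> * D = (\<Sum>j\<in>?K \<inter> H. \<delta> * \<bar>d j\<bar>)"
        unfolding D_def sum_distrib_left by (rule arg_cong[symmetric])
      also have "\<dots> = (\<Sum>j\<in>?K. if j \<in> H then \<delta> * \<bar>d j\<bar> else 0)"
        by (intro sum.inter_restrict) simp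
      also have "\<dots> \<le> (\<Sum>j\<in>?K. (q j - q j0) * d j)"
      proof (intro sum_mono)
        fix j assume j: "j \<in> ?K"
        \<comment> \<open>\<open>x'\<close> accepts everything before the threshold and nothing
          after it, so \<open>d j\<close> and \<open>q j - q j0\<close> never have opposite
          signs.\<close>
        have abs: "(q j - q j0) * d j = \<bar>q j - q j0\<bar> * \<bar>d j\<bar>"
        proof (cases j j0 rule: linorder_cases)
          case less
          then have "q j0 \<le> q j" "0 \<le> d j" using q_antimono_ties[of j j0] j j0 lo[OF j] bspec[OF xn j] p_bounds[OF j]
            by (auto simp: d_def)
          then show ?thesis by simp
        next
          case greater
          then have "q j \<le> q j0" "d j \<le> 0" using q_antimono_ties[of j0 j] j j0 hi[OF j] p_bounds[OF j]
            by (auto simp: d_def)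
          then have "\<bar>q j - q j0\<bar> = - (q j - q j0)" "\<bar>d j\<bar> = - d j" by linarith+
          then show ?thesis by (simp add: algebra_simps)
        qed simp
        show "(if j \<in> H then \<delta> * \<bar>d j\<bar> else 0) \<le> (q j - q j0) * d j"
          unfolding abs using \<delta>(2)[OF j j0] j by (auto simp: H_def G_def intro: mult_right_mono)
      qed
      finally show ?thesis .
    qed
    ultimately have gain: "\<delta> * D - 1 \<le> (\<Sum>j\<in>?K. v j * real (x' j)) - (\<Sum>j\<in>?K. v j * real (x j))"
      unfolding rev by linarith

    \<comment> \<open>Only the gained customers \<open>a\<close> and the lost customers
      \<open>b\<close> are compared; the common part \<open>w\<close> is absorbed into
      \<phi>.\<close>
    define a where "a j = x' j - x j" for j
    define b where "b j = x j - x' j" for j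
    define w where "w j = min (x j) (x' j)" for j
    define \<phi> where "\<phi> = berns (all_shows w) (excess B)"
    have ic: "icx \<phi>" unfolding \<phi>_def by (intro icx_berns icx_excess prob_show_mset) auto
    have lip: "\<phi> t \<le> \<phi> s + (t - s)" if "s \<le> t" for s t
      proof -
      have "\<phi> t - \<phi> s \<le> t - s" using ic that unfolding icx_def by blast
      then show ?thesis by linarith
    qed
    have split: "all_shows (\<lambda>j. w j + z j) = show_mset p G z + (show_mset p H z + all_shows w)" for z
      unfolding show_mset_add H_def using show_mset_Diff[OF _ GK, of p z] by (simp add: add_ac)
    have "x = (\<lambda>j. w j + b j)" "x' = (\<lambda>j. w j + a j)" by (auto simp: w_def a_def b_def)
    then have Vx: "berns (all_shows x) (excess B) 0 = berns (show_mset p G b) (berns (show_mset p H b) \<phi>) 0"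
      and Vx': "berns (all_shows x') (excess B) 0 = berns (show_mset p G a) (berns (show_mset p H a) \<phi>) 0"
      using split[of a] split[of b] by (simp_all add: berns_union \<phi>_def)
    define \<mu>a where "\<mu>a = sum_mset (show_mset p H a)"
    define \<mu>b where "\<mu>b = sum_mset (show_mset p H b)"
    have \<mu>0: "0 \<le> \<mu>a" "0 \<le> \<mu>b" unfolding \<mu>a_def \<mu>b_def using HK
      by (auto intro!: sum_mset_prob_nonneg prob_show_mset)
    have ab: "p j * real (a j) + p j * real (b j) = \<bar>d j\<bar>" "p j * real (a j) - p j * real (b j) = d j"
      if "j \<in> ?K" for j
      using p_bounds[OF that] by (auto simp: a_def b_def d_def abs_mult algebra_simps of_nat_diff_if abs_if)
    have \<mu>D: "\<mu>a + \<mu>b = D"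
      unfolding \<mu>a_def \<mu>b_def D_def sum_mset_show_mset sum.distrib[symmetric]
      using HK ab by (intro sum.cong) auto
    have "sum_mset (all_shows a) - sum_mset (all_shows b) = (\<Sum>j\<in>?K. d j)"
      unfolding sum_mset_show_mset sum_subtractf[symmetric] using ab by (intro sum.cong) auto
    then have means: "sum_mset (show_mset p G a) + \<mu>a \<le> sum_mset (show_mset p G b) + \<mu>b"
      using sd mean show_mset_Diff[OF _ GK, of p a] show_mset_Diff[OF _ GK, of p b]
      by (simp add: \<mu>a_def \<mu>b_def H_def)

    \<comment> \<open>Outside \<open>G\<close> the show-up probabilities are unordered, which blocks
      majorization. The gain in \<open>H\<close> is therefore replaced by \<open>N1\<close> certain
      show-ups and the loss by \<open>N2\<close> variables of parameter \<pi>, so that \<pi>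
      separates both sides. Rounding \<open>N1\<close> down and \<open>N2\<close> up keeps the means
      in order.\<close>
    define N1 where "N1 = nat \<lfloor>\<mu>a\<rfloor>"
    have N1: "real N1 \<le> \<mu>a" "\<mu>a \<le> real N1 + 1" using \<mu>0 unfolding N1_def by linarith+
    define N2 where "N2 = nat \<lceil>\<mu>b / \<pi>\<rceil>"
    have "0 \<le> \<mu>b / \<pi>" using \<mu>0 \<pi> by simp
    then have "\<mu>b / \<pi> \<le> real N2" "real N2 \<le> \<mu>b / \<pi> + 1" unfolding N2_def by linarith+
    then have N2: "\<mu>b \<le> real N2 * \<pi>" "real N2 * \<pi> \<le> \<mu>b + 1" using \<pi> by (auto simp: field_simps)

    define X where "X = show_mset p G a + replicate_mset N1 1"
    define Y where "Y = show_mset p G b + replicate_mset N2 \<pi>"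
    have "berns (show_mset p H a) \<phi> s \<le> berns (replicate_mset N1 1) \<phi> s + (1 + \<mu>a / (2 * c) + c / 2)" for s
    proof -
      have "berns (show_mset p H a) \<phi> s \<le> \<phi> (s + \<mu>a) + \<mu>a / (2 * c) + c / 2"
        unfolding \<mu>a_def using HK by (intro berns_le_mean ic prob_show_mset c)
      also have "\<phi> (s + \<mu>a) \<le> \<phi> (s + real N1) + 1" using lip[of "s + real N1" "s + \<mu>a"] N1 by simp
      finally show ?thesis by (simp add: berns_replicate_one)
    qed
    then have "berns (all_shows x') (excess B) 0
        \<le> berns (show_mset p G a) (\<lambda>s. berns (replicate_mset N1 1) \<phi> s + (1 + \<mu>a / (2 * c) + c / 2)) 0"
      unfolding Vx' by (intro berns_mono prob_show_mset GK)
    also have "\<dots> = berns (add_mset 0 X) \<phi> 0 + (1 + \<mu>a / (2 * c) + c / 2)"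
      unfolding berns_add_const X_def by (simp add: berns_union berns_add_mset bern_def)
    \<comment> \<open>In \<open>G\<close>, gained types are at most \<open>j0\<close> and lost types
      at least \<open>j0\<close>, so the tie-breaking order puts \<pi> between their parameters. The
      extra parameter of the majorization starts at 0.\<close>
    also have "berns (add_mset 0 X) \<phi> 0 \<le> berns Y \<phi> 0"
    proof (rule berns_majorization[OF ic, where c = \<pi>])
      fix y assume "y \<in># X"
      then consider "y \<in># show_mset p G a" | "y = 1" by (auto simp: X_def split: if_splits)
      then show "\<pi> \<le> y \<and> y \<le> 1"
      proof cases
        case 1
        then obtain j where j: "j \<in> G" "0 < a j" "y = p j" using in_show_mset[OF fin(1)] by blast
        then have jK: "j \<in> ?K" "q j = q j0" by (auto simp: G_def)
        have "\<not> j0 < j" using hi[OF jK(1)] j(2) by (auto simp: a_def)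
        then show ?thesis using q_antimono_ties[of j j0] jK j0 p_bounds[of j] j(3) by (auto simp: \<pi>_def)
      qed (use \<pi> in auto)
    next
      fix y assume "y \<in># Y"
      then consider "y \<in># show_mset p G b" | "y = \<pi>" by (auto simp: Y_def split: if_splits)
      then show "0 \<le> y \<and> y \<le> \<pi>"
      proof cases
        case 1
        then obtain j where j: "j \<in> G" "0 < b j" "y = p j" using in_show_mset[OF fin(1)] by blast
        then have jK: "j \<in> ?K" "q j = q j0" by (auto simp: G_def)
        have "\<not> j < j0" using lo[OF jK(1)] bspec[OF xn jK(1)] j(2) by (auto simp: b_def)
        then show ?thesis using q_antimono_ties[of j0 j] jK j0 p_bounds[of j] j(3) by (auto simp: \<pi>_def)
      qed (use \<pi> in auto)
    next
      show "0 + sum_mset X \<le> sum_mset Y"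
        using means N1 N2 by (simp add: X_def Y_def)
    qed (use \<pi> in auto)
    also have "berns Y \<phi> 0 = berns (show_mset p G b) (berns (replicate_mset N2 \<pi>) \<phi>) 0"
      by (simp add: Y_def berns_union)
    also have "\<dots> \<le> berns (show_mset p G b)
        (\<lambda>s. berns (show_mset p H b) \<phi> s + (1 + (\<mu>b + 1) / (2 * c) + c / 2)) 0"
    proof (intro berns_mono prob_show_mset GK)
      fix s
      have "berns (replicate_mset N2 \<pi>) \<phi> s \<le> \<phi> (s + real N2 * \<pi>) + real N2 * \<pi> / (2 * c) + c / 2"
        using berns_le_mean[OF ic _ c, of "replicate_mset N2 \<pi>" s] \<pi> by (simp)
      also have "\<phi> (s + real N2 * \<pi>) \<le> \<phi> (s + \<mu>b) + 1" using lip[of "s + \<mu>b" "s + real N2 * \<pi>"] N2 by simp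
      also have "\<phi> (s + \<mu>b) \<le> berns (show_mset p H b) \<phi> s"
        unfolding \<mu>b_def using HK by (intro berns_jensen ic prob_show_mset)
      also have "real N2 * \<pi> / (2 * c) \<le> (\<mu>b + 1) / (2 * c)" using N2 c by (intro divide_right_mono) auto
      finally show "berns (replicate_mset N2 \<pi>) \<phi> s
          \<le> berns (show_mset p H b) \<phi> s + (1 + (\<mu>b + 1) / (2 * c) + c / 2)" by simp
    qed
    also have "\<dots> = berns (all_shows x) (excess B) 0 + (1 + (\<mu>b + 1) / (2 * c) + c / 2)"
      unfolding berns_add_const Vx ..
    finally have "berns (all_shows x') (excess B) 0
        \<le> berns (all_shows x) (excess B) 0 + (2 + c + (\<mu>a + \<mu>b + 1) / (2 * c))"
      by (simp add: add_divide_distrib)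
    also have "(\<mu>a + \<mu>b + 1) / (2 * c) = \<delta> * D / 2 + \<delta> / 2"
      unfolding \<mu>D by (simp add: c_def field_simps)
    finally have "berns (all_shows x') (excess B) 0
        \<le> berns (all_shows x) (excess B) 0 + (2 + 1 / \<delta> + \<delta> * D / 2 + \<delta> / 2)" by (simp add: c_def)
    moreover have "0 \<le> \<delta> * D" using \<delta> D0 by simp
    ultimately show ?thesis
      using gain ind by (intro exI[of _ x']) (simp add: objective_eq)
  qed
  then show ?thesis using that by blast
qed

section \<open>Marginal values of the objective\<close>

text \<open>The probability that the capacity is exhausted; accepting one more customer of type \<open>j\<close> changes
  the objective by \<open>p j * (q j - crit B x)\<close>.\<close>

definition crit :: "nat \<Rightarrow> (nat \<Rightarrow> nat) \<Rightarrow> real" where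
  "crit B x = berns (all_shows x) (overflow B) 0"

lemma crit_mono:
  assumes "\<And>j. j \<in> {1..k} \<Longrightarrow> z j \<le> x j"
  shows "crit B z \<le> crit B x"
proof -
  have "all_shows x = all_shows (\<lambda>j. (x j - z j) + z j)" using assms by (intro show_mset_cong) auto
  then show ?thesis
    unfolding crit_def show_mset_add by (auto intro!: berns_overflow_mono prob_show_mset)
qed

lemma crit_le_1: "crit B x \<le> 1"
  unfolding crit_def using berns_mono[OF prob_show_mset, of "{1..k}" "overflow B" "\<lambda>_. 1" x 0]
  by (simp add: overflow_le)

lemma crit_nonneg: "0 \<le> crit B x"
  unfolding crit_def using berns_mono[OF prob_show_mset, of "{1..k}" "\<lambda>_. 0" "overflow B" x 0]
  by (simp add: overflow_nonneg)

lemma objective_cong: "(\<And>j. j \<in> {1..k} \<Longrightarrow> x j = y j) \<Longrightarrow> objective k v p B x = objective k v p B y"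
  unfolding objective_eq using show_mset_cong[of "{1..k}" x y p] by simp

text \<open>On the way from \<open>z\<close> to \<open>x\<close> the overflow probability only
  grows, so pricing every added customer at \<open>crit B z\<close> overstates its value; pricing at
  \<open>crit B x\<close>, as in \<open>objective_lower\<close>, understates it.\<close>

lemma objective_upper:
  assumes "\<And>j. j \<in> {1..k} \<Longrightarrow> z j \<le> x j"
  shows "objective k v p B x \<le> objective k v p B z
    + (\<Sum>j\<in>{1..k}. p j * (q j - crit B z) * real (x j - z j))"
proof -
  have "all_shows x = all_shows (\<lambda>j. (x j - z j) + z j)" using assms by (intro show_mset_cong) auto
  then have "berns (all_shows z) (excess B) 0 + (\<Sum>j\<in>{1..k}. p j * real (x j - z j)) * crit B z
      \<le> berns (all_shows x) (excess B) 0"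
    unfolding crit_def sum_mset_show_mset[symmetric] show_mset_add
    by (auto intro!: berns_excess_ge prob_show_mset)
  moreover have "(\<Sum>j\<in>{1..k}. v j * real (x j)) = (\<Sum>j\<in>{1..k}. v j * real (z j))
      + (\<Sum>j\<in>{1..k}. p j * q j * real (x j - z j))"
    unfolding sum.distrib[symmetric]
    using assms by (intro sum.cong) (auto simp: v_eq of_nat_diff algebra_simps)
  moreover have "(\<Sum>j\<in>{1..k}. p j * (q j - crit B z) * real (x j - z j)) =
    (\<Sum>j\<in>{1..k}. p j * q j * real (x j - z j)) - (\<Sum>j\<in>{1..k}. p j * real (x j - z j)) * crit B z"
    unfolding sum_distrib_right sum_subtractf[symmetric] by (intro sum.cong) (auto simp: algebra_simps)
  ultimately show ?thesis unfolding objective_eq by linarith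
qed

lemma objective_lower:
  assumes "\<And>j. j \<in> {1..k} \<Longrightarrow> z j \<le> x j"
  shows "objective k v p B z + (\<Sum>j\<in>{1..k}. p j * (q j - crit B x) * real (x j - z j))
    \<le> objective k v p B x"
proof -
  have "all_shows x = all_shows (\<lambda>j. (x j - z j) + z j)" using assms by (intro show_mset_cong) auto
  then have "berns (all_shows x) (excess B) 0 \<le>
     berns (all_shows z) (excess B) 0 + (\<Sum>j\<in>{1..k}. p j * real (x j - z j)) * crit B x"
    unfolding crit_def sum_mset_show_mset[symmetric] show_mset_add
    by (auto intro!: berns_excess_le prob_show_mset)
  moreover have "(\<Sum>j\<in>{1..k}. v j * real (x j)) = (\<Sum>j\<in>{1..k}. v j * real (z j))
      + (\<Sum>j\<in>{1..k}. p j * q j * real (x j - z j))"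
    unfolding sum.distrib[symmetric]
    using assms by (intro sum.cong) (auto simp: v_eq of_nat_diff algebra_simps)
  moreover have "(\<Sum>j\<in>{1..k}. p j * (q j - crit B x) * real (x j - z j)) =
    (\<Sum>j\<in>{1..k}. p j * q j * real (x j - z j)) - (\<Sum>j\<in>{1..k}. p j * real (x j - z j)) * crit B x"
    unfolding sum_distrib_right sum_subtractf[symmetric] by (intro sum.cong) (auto simp: algebra_simps)
  ultimately show ?thesis unfolding objective_eq by linarith
qed

lemma objective_add_one:
  assumes "j \<in> {1..k}"
  shows "objective k v p B (z(j := z j + 1)) = objective k v p B z + p j * (q j - crit B z)"
proof -
  have eq: "z(j := z j + 1) = (\<lambda>i. (if i = j then 1 else 0) + z i)" by auto
  have "all_shows (z(j := z j + 1)) = add_mset (p j) (all_shows z)"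
    unfolding eq show_mset_add using assms by (subst show_mset_single) auto
  moreover have "(\<Sum>i\<in>{1..k}. v i * real ((z(j := z j + 1)) i)) =
     (\<Sum>i\<in>{1..k}. v i * real (z i) + (if i = j then v i else 0))"
    by (intro sum.cong) (auto simp: algebra_simps)
  then have "(\<Sum>i\<in>{1..k}. v i * real ((z(j := z j + 1)) i)) = (\<Sum>i\<in>{1..k}. v i * real (z i)) + v j"
    using assms by (simp add: sum.distrib)
  ultimately show ?thesis
    unfolding objective_eq crit_def using assms by (simp add: berns_add_one v_eq algebra_simps)
qed

subsection \<open>Loss of a single decision\<close>

definition index_opt :: "nat \<Rightarrow> (nat \<Rightarrow> nat) \<Rightarrow> (nat \<Rightarrow> nat) \<Rightarrow> real" where
  "index_opt B y n = Max (offline_objective k v p B y ` {x. index_solution k n x})"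

lemma finite_index_solutions: "finite {x. index_solution k n x}"
  by (rule finite_subset[of _ "offline_feasible k n"])
     (auto simp: index_solution_def offline_feasible_def intro!: finite_PiE)

lemma index_solution_prefix:
  assumes "j \<in> {1..k}" "m \<le> n j"
  shows "index_solution k n (\<lambda>i\<in>{1..k}. if i < j then n i else if i = j then m else 0)"
  using assms by (auto simp: index_solution_def offline_feasible_def intro!: bexI[of _ j])

lemma index_opt_ge: "index_solution k n x \<Longrightarrow> objective k v p B (\<lambda>j. y j + x j) \<le> index_opt B y n"
  unfolding index_opt_def using finite_index_solutions
  by (auto simp: offline_objective_def intro!: Max_ge)

lemma index_opt_attained:
  obtains x where "index_solution k n x" "index_opt B y n = objective k v p B (\<lambda>j. y j + x j)"
proof -
  have "{x. index_solution k n x} \<noteq> {}"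
    using index_solution_prefix[of 1 0 n] k_pos by auto
  then have "index_opt B y n \<in> offline_objective k v p B y ` {x. index_solution k n x}"
    unfolding index_opt_def using finite_index_solutions by (intro Max_in) auto
  then show ?thesis using that by (auto simp: offline_objective_def)
qed

text \<open>If an optimal index solution of the instance with the current customer serves some type
  \<open>j\<close>, the accepted customer may be one of those and nothing is lost. Otherwise its
  threshold is at most \<open>j\<close>, and forcing one in costs a marginal value at a state
  dominated by the one with all earlier types accepted.\<close>

lemma index_opt_accept:
  assumes j: "j \<in> {1..k}"
  shows "index_opt B y (m(j := m j + 1)) \<le> index_opt B (y(j := y j + 1)) m
    + max 0 (p j * (crit B (\<lambda>i. y i + (if i < j then m i else 0)) - q j))"
proof -
  let ?n = "m(j := m j + 1)"
  obtain x where x: "index_solution k ?n x"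
    and opt: "index_opt B y ?n = objective k v p B (\<lambda>i. y i + x i)"
    by (rule index_opt_attained)
  obtain j0 where j0: "j0 \<in> {1..k}" "\<And>i. i \<in> {1..k} \<Longrightarrow> i < j0 \<Longrightarrow> x i = ?n i"
      "\<And>i. i \<in> {1..k} \<Longrightarrow> j0 < i \<Longrightarrow> x i = 0"
    using x unfolding index_solution_def by blast
  have feas: "x i \<le> ?n i" if "i \<in> {1..k}" for i
    using x that by (auto simp: index_solution_def offline_feasible_def PiE_def Pi_def)
  have ext: "x \<in> extensional {1..k}" using x by (auto simp: index_solution_def offline_feasible_def PiE_def)
  show ?thesis
  proof (cases "x j")
    case (Suc a)
    have ind: "index_solution k m (x(j := a))"
      unfolding index_solution_def offline_feasible_def
    proof (intro conjI bexI[of _ j0] ballI impI PiE_I)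
      fix i assume "i \<in> {1..k}"
      then show "(x(j := a)) i \<in> {0..m i}" using feas[of i] Suc by auto
    next
      fix i assume "i \<notin> {1..k}"
      then show "(x(j := a)) i = undefined" using ext j by (auto simp: extensional_def)
    next
      fix i assume "i \<in> {1..k}" "i < j0"
      then show "(x(j := a)) i = m i" using j0(2)[of i] Suc by (auto split: if_splits)
    next
      fix i assume "i \<in> {1..k}" "j0 < i"
      then show "(x(j := a)) i = 0" using j0(3)[of i] Suc by (auto split: if_splits)
    qed (use j0 in auto)
    have eq: "(\<lambda>i. (y(j := y j + 1)) i + (x(j := a)) i) = (\<lambda>i. y i + x i)" using Suc by auto
    show ?thesis
      using index_opt_ge[OF ind, of B "y(j := y j + 1)"] unfolding eq opt by linarith
  next
    case 0
    have j0j: "j0 \<le> j" using j0(2)[OF j] 0 by (cases "j < j0") auto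
    have "index_solution k m x"
      unfolding index_solution_def offline_feasible_def
    proof (intro conjI bexI[of _ j0] ballI impI PiE_I)
      fix i assume "i \<in> {1..k}"
      then show "x i \<in> {0..m i}" using feas[of i] 0 by (auto split: if_splits)
    next
      fix i assume "i \<notin> {1..k}"
      then show "x i = undefined" using ext by (auto simp: extensional_def)
    next
      fix i assume "i \<in> {1..k}" "i < j0"
      then show "x i = m i" using j0(2)[of i] j0j by auto
    qed (use j0 in auto)
    from index_opt_ge[OF this, of B "y(j := y j + 1)"]
    have le: "objective k v p B (\<lambda>i. (y(j := y j + 1)) i + x i) \<le> index_opt B (y(j := y j + 1)) m" .
    have eq: "(\<lambda>i. (y(j := y j + 1)) i + x i) = (\<lambda>i. y i + x i)(j := y j + x j + 1)" by auto
    have "objective k v p B (\<lambda>i. (y(j := y j + 1)) i + x i)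
        = objective k v p B (\<lambda>i. y i + x i) + p j * (q j - crit B (\<lambda>i. y i + x i))"
      unfolding eq by (rule objective_add_one[OF j, of B "\<lambda>i. y i + x i"])
    then have "index_opt B y ?n \<le> index_opt B (y(j := y j + 1)) m + p j * (crit B (\<lambda>i. y i + x i) - q j)"
      using le unfolding opt by (simp add: algebra_simps)
    also have "p j * (crit B (\<lambda>i. y i + x i) - q j) \<le> p j * (crit B (\<lambda>i. y i + (if i < j then m i else 0)) - q j)"
    proof (intro mult_left_mono diff_right_mono crit_mono)
      fix i assume i: "i \<in> {1..k}"
      show "y i + x i \<le> y i + (if i < j then m i else 0)"
        using feas[OF i] j0(3)[OF i] j0j 0 by (cases i j rule: linorder_cases) auto
    qed (use p_bounds[OF j] in auto)
    finally show ?thesis by linarith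
  qed
qed

text \<open>Dually, a loss arises only if the optimum serves all \<open>m j + 1\<close> customers of
  type \<open>j\<close>. It then contains all future customers of types up to \<open>j\<close>, and
  \<open>crit\<close> at that prefix limits the value of the one given up.\<close>

lemma index_opt_reject:
  assumes j: "j \<in> {1..k}"
  shows "index_opt B y (m(j := m j + 1)) \<le> index_opt B y m
    + max 0 (p j * (q j - crit B (\<lambda>i. y i + (if i \<le> j then m i else 0))))"
proof -
  let ?n = "m(j := m j + 1)"
  obtain x where x: "index_solution k ?n x"
    and opt: "index_opt B y ?n = objective k v p B (\<lambda>i. y i + x i)"
    by (rule index_opt_attained)
  obtain j0 where j0: "j0 \<in> {1..k}" "\<And>i. i \<in> {1..k} \<Longrightarrow> i < j0 \<Longrightarrow> x i = ?n i"
      "\<And>i. i \<in> {1..k} \<Longrightarrow> j0 < i \<Longrightarrow> x i = 0"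
    using x unfolding index_solution_def by blast
  have feas: "x i \<le> ?n i" if "i \<in> {1..k}" for i
    using x that by (auto simp: index_solution_def offline_feasible_def PiE_def Pi_def)
  have ext: "x \<in> extensional {1..k}" using x by (auto simp: index_solution_def offline_feasible_def PiE_def)
  show ?thesis
  proof (cases "x j \<le> m j")
    case True
    have j0j: "j0 \<le> j" using j0(2)[OF j] True by (cases "j < j0") auto
    have "index_solution k m x"
      unfolding index_solution_def offline_feasible_def
    proof (intro conjI bexI[of _ j0] ballI impI PiE_I)
      fix i assume "i \<in> {1..k}"
      then show "x i \<in> {0..m i}" using feas[of i] True by (auto split: if_splits)
    next
      fix i assume "i \<notin> {1..k}"
      then show "x i = undefined" using ext by (auto simp: extensional_def)
    next
      fix i assume "i \<in> {1..k}" "i < j0"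
      then show "x i = m i" using j0(2)[of i] j0j by auto
    qed (use j0 in auto)
    then show ?thesis unfolding opt using index_opt_ge[of m x B y] by linarith
  next
    case False
    then have xj: "x j = m j + 1" using feas[OF j] by auto
    then have j0j: "j \<le> j0" using j0(3)[OF j] by (cases "j0 < j") auto
    define x' where "x' = x(j := m j)"
    have "index_solution k m x'"
      unfolding index_solution_def offline_feasible_def x'_def
    proof (intro conjI bexI[of _ j0] ballI impI PiE_I)
      fix i assume "i \<in> {1..k}"
      then show "(x(j := m j)) i \<in> {0..m i}" using feas[of i] by auto
    next
      fix i assume "i \<notin> {1..k}"
      then show "(x(j := m j)) i = undefined" using ext j by (auto simp: extensional_def)
    next
      fix i assume "i \<in> {1..k}" "i < j0"
      then show "(x(j := m j)) i = m i" using j0(2)[of i] by auto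
    next
      fix i assume "i \<in> {1..k}" "j0 < i"
      then show "(x(j := m j)) i = 0" using j0(3)[of i] j0j by auto
    qed (use j0 in auto)
    then have le: "objective k v p B (\<lambda>i. y i + x' i) \<le> index_opt B y m"
      by (rule index_opt_ge)
    have eq: "(\<lambda>i. y i + x i) = (\<lambda>i. y i + x' i)(j := y j + x' j + 1)" by (auto simp: x'_def xj)
    have "objective k v p B (\<lambda>i. y i + x i)
        = objective k v p B (\<lambda>i. y i + x' i) + p j * (q j - crit B (\<lambda>i. y i + x' i))"
      unfolding eq by (rule objective_add_one[OF j, of B "\<lambda>i. y i + x' i"])
    then have "index_opt B y ?n \<le> index_opt B y m + p j * (q j - crit B (\<lambda>i. y i + x' i))"
      unfolding opt using le by simp
    also have "p j * (q j - crit B (\<lambda>i. y i + x' i)) \<le> p j * (q j - crit B (\<lambda>i. y i + (if i \<le> j then m i else 0)))"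
    proof (intro mult_left_mono diff_left_mono crit_mono)
      fix i assume i: "i \<in> {1..k}"
      show "y i + (if i \<le> j then m i else 0) \<le> y i + x' i"
        using j0(2)[OF i] j0j by (auto simp: x'_def)
    qed (use p_bounds[OF j] in auto)
    finally show ?thesis by linarith
  qed
qed

lemma optimal_index_ge_prefix:
  assumes "optimal_index_solution k v p B y n x" "j \<in> {1..k}" "b \<le> n j"
  shows "objective k v p B (\<lambda>i. y i + (if i < j then n i else if i = j then b else 0))
    \<le> objective k v p B (\<lambda>i. y i + x i)"
proof -
  define w where "w = (\<lambda>i\<in>{1..k}. if i < j then n i else if i = j then b else 0)"
  have "index_solution k n w" unfolding w_def using assms(2,3) by (rule index_solution_prefix)
  then have "objective k v p B (\<lambda>i. y i + w i) \<le> objective k v p B (\<lambda>i. y i + x i)"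
    using assms(1) unfolding optimal_index_solution_def offline_objective_def by blast
  also have "objective k v p B (\<lambda>i. y i + w i) =
      objective k v p B (\<lambda>i. y i + (if i < j then n i else if i = j then b else 0))"
    by (intro objective_cong) (auto simp: w_def)
  finally show ?thesis .
qed

text \<open>Cut \<open>x\<close> back to the prefix with only \<open>b\<close> customers of type
  \<open>j\<close>. Those removed have ratio at most \<open>q j\<close>; were \<open>crit\<close>
  above it, each would have negative marginal value and the cut would strictly improve on
  \<open>x\<close>.\<close>

lemma optimal_index_crit_le:
  assumes "optimal_index_solution k v p B y n x" "j \<in> {1..k}" "b < x j"
  shows "crit B (\<lambda>i. y i + (if i < j then n i else if i = j then b else 0)) \<le> q j"
proof (rule ccontr)
  let ?z = "\<lambda>i. y i + (if i < j then n i else if i = j then b else 0)"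
  assume "\<not> crit B ?z \<le> q j"
  then have c: "q j < crit B ?z" by simp
  have x: "index_solution k n x" using assms(1) by (simp add: optimal_index_solution_def)
  then have feas: "x i \<le> n i" if "i \<in> {1..k}" for i
    using that by (auto simp: index_solution_def offline_feasible_def PiE_def Pi_def)
  obtain j0 where j0: "j0 \<in> {1..k}" "\<And>i. i \<in> {1..k} \<Longrightarrow> i < j0 \<Longrightarrow> x i = n i"
      "\<And>i. i \<in> {1..k} \<Longrightarrow> j0 < i \<Longrightarrow> x i = 0"
    using x unfolding index_solution_def by blast
  have j0j: "j \<le> j0" using j0(3)[OF assms(2)] assms(3) by (cases "j0 < j") auto
  have "b \<le> n j" using assms(3) feas[OF assms(2)] by simp
  then have "objective k v p B ?z \<le> objective k v p B (\<lambda>i. y i + x i)"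
    using assms(1,2) by (intro optimal_index_ge_prefix)
  also have "objective k v p B (\<lambda>i. y i + x i) \<le> objective k v p B ?z
      + (\<Sum>i\<in>{1..k}. p i * (q i - crit B ?z) * real (y i + x i - ?z i))"
    using j0(2) j0j assms(3) by (intro objective_upper) auto
  also have "(\<Sum>i\<in>{1..k}. p i * (q i - crit B ?z) * real (y i + x i - ?z i)) < (\<Sum>i\<in>{1..k}. 0)"
  proof (rule sum_strict_mono_ex1)
    show "\<forall>i\<in>{1..k}. p i * (q i - crit B ?z) * real (y i + x i - ?z i) \<le> 0"
    proof
      fix i assume i: "i \<in> {1..k}"
      show "p i * (q i - crit B ?z) * real (y i + x i - ?z i) \<le> 0"
      proof (cases "i < j")
        case True
        then show ?thesis using feas[OF i] by simp
      next
        case False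
        then have "q i \<le> q j" using q_antimono_ties[of j i] i assms(2) by auto
        then show ?thesis using c p_bounds[OF i]
          by (intro mult_nonpos_nonneg mult_nonneg_nonpos) auto
      qed
    qed
    show "\<exists>i\<in>{1..k}. p i * (q i - crit B ?z) * real (y i + x i - ?z i) < 0"
      using c p_bounds[OF assms(2)] assms(2,3)
      by (intro bexI[of _ j] mult_neg_pos mult_pos_neg) auto
  qed simp
  finally show False by simp
qed

text \<open>The prefix extends \<open>x\<close> by customers of ratio at least \<open>q j\<close>.
  Were \<open>crit\<close> below \<open>q j\<close>, these additions would not hurt, and one further
  type \<open>j\<close> customer would strictly improve on \<open>x\<close>.\<close>

lemma optimal_index_crit_ge:
  assumes "optimal_index_solution k v p B y n x" "j \<in> {1..k}" "x j \<le> b" "b < n j"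
  shows "q j \<le> crit B (\<lambda>i. y i + (if i < j then n i else if i = j then b else 0))"
proof (rule ccontr)
  let ?z = "\<lambda>i. y i + (if i < j then n i else if i = j then b else 0)"
  assume "\<not> q j \<le> crit B ?z"
  then have c: "crit B ?z < q j" by simp
  have x: "index_solution k n x" using assms(1) by (simp add: optimal_index_solution_def)
  then have feas: "x i \<le> n i" if "i \<in> {1..k}" for i
    using that by (auto simp: index_solution_def offline_feasible_def PiE_def Pi_def)
  obtain j0 where j0: "j0 \<in> {1..k}" "\<And>i. i \<in> {1..k} \<Longrightarrow> i < j0 \<Longrightarrow> x i = n i"
      "\<And>i. i \<in> {1..k} \<Longrightarrow> j0 < i \<Longrightarrow> x i = 0"
    using x unfolding index_solution_def by blast
  have j0j: "j0 \<le> j" using j0(2)[OF assms(2)] assms(3,4) by (cases "j < j0") auto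
  have "Suc b \<le> n j" using assms(4) by simp
  then have "objective k v p B (\<lambda>i. y i + (if i < j then n i else if i = j then Suc b else 0))
      \<le> objective k v p B (\<lambda>i. y i + x i)"
    using assms(1,2) by (intro optimal_index_ge_prefix)
  also have "(\<lambda>i. y i + (if i < j then n i else if i = j then Suc b else 0)) = ?z(j := ?z j + 1)"
    by auto
  also have "objective k v p B (?z(j := ?z j + 1)) = objective k v p B ?z + p j * (q j - crit B ?z)"
    by (rule objective_add_one[OF assms(2)])
  finally have le: "objective k v p B ?z + p j * (q j - crit B ?z) \<le> objective k v p B (\<lambda>i. y i + x i)" .
  have "0 \<le> (\<Sum>i\<in>{1..k}. p i * (q i - crit B ?z) * real (?z i - (y i + x i)))"
  proof (rule sum_nonneg)
    fix i assume i: "i \<in> {1..k}"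
    show "0 \<le> p i * (q i - crit B ?z) * real (?z i - (y i + x i))"
    proof (cases "j < i")
      case False
      then have "q j \<le> q i" using q_antimono_ties[of i j] i assms(2) by auto
      then show ?thesis using c p_bounds[OF i] by (intro mult_nonneg_nonneg) auto
    qed simp
  qed
  also have "objective k v p B (\<lambda>i. y i + x i) +
      (\<Sum>i\<in>{1..k}. p i * (q i - crit B ?z) * real (?z i - (y i + x i))) \<le> objective k v p B ?z"
    using feas j0(3) j0j assms(3) by (intro objective_lower) auto
  ultimately have "p j * (q j - crit B ?z) \<le> 0" using le by linarith
  moreover have "0 < p j * (q j - crit B ?z)" using c p_bounds[OF assms(2)] by simp
  ultimately show False by simp
qed

text \<open>A Chernoff bound: \<open>b\<close> extra customers of type \<open>j\<close> outweigh the counts missing in \<open>n'\<close>, up to an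
  exponentially small error.\<close>

lemma crit_compare:
  assumes j: "j \<in> {1..k}" and \<theta>: "0 \<le> \<theta>" "\<theta> \<le> 1"
  shows "crit B (\<lambda>i. y i + (if i < j then n i else 0))
    \<le> crit B (\<lambda>i. y i + (if i < j then n' i else if i = j then b else 0))
      + exp (\<theta> * ((\<Sum>i\<in>{1..k}. if i < j then real (n i - n' i) else 0) - p j * real b / 2))"
    (is "_ \<le> crit B ?z' + ?E")
proof -
  \<comment> \<open>The counts common to \<open>n\<close> and \<open>n'\<close> are kept. The
    surplus \<open>e\<close> of \<open>n\<close> is charged as if all its \<open>D\<close> customers
    showed up; the \<open>b\<close> extra customers have to cover this shift.\<close>
  define w where "w i = y i + (if i < j then min (n i) (n' i) else 0)" for i
  define e where "e i = (if i < j then n i - n' i else 0)" for i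
  define D where "D = real (size (all_shows e))"
  have D: "D = (\<Sum>i\<in>{1..k}. if i < j then real (n i - n' i) else 0)"
    unfolding D_def size_show_mset of_nat_sum by (intro sum.cong) (auto simp: e_def)
  have pw: "prob_mset (all_shows w)" by (intro prob_show_mset) auto
  have pj: "0 \<le> p j" "p j \<le> 1" using p_bounds[OF j] by auto
  have "(\<lambda>i. y i + (if i < j then n i else 0)) = (\<lambda>i. e i + w i)" by (auto simp: w_def e_def fun_eq_iff min_def)
  then have "crit B (\<lambda>i. y i + (if i < j then n i else 0)) =
      berns (all_shows e) (berns (all_shows w) (overflow B)) 0"
    by (simp add: crit_def show_mset_add berns_union)
  also have "\<dots> \<le> berns (all_shows w) (overflow B) (0 + D)"
    unfolding D_def by (intro berns_le_shift prob_show_mset mono_berns pw overflow_mono) auto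
  also have "\<dots> = berns (all_shows w) (\<lambda>t. overflow B (t + D)) 0" by (rule berns_shift[symmetric])
  also have "\<dots> \<le> berns (all_shows w) (\<lambda>t. berns (replicate_mset b (p j)) (overflow B) t
      + exp (\<theta> * (D - p j * real b / 2))) 0"
    using berns_replicate_overflow_ge[OF pj \<theta>] by (intro berns_mono pw) (simp add: algebra_simps)
  also have "\<dots> = crit B (\<lambda>i. w i + (if i = j then b else 0)) + exp (\<theta> * (D - p j * real b / 2))"
    unfolding berns_add_const crit_def show_mset_add using j
    by (subst show_mset_single) (auto simp: berns_union)
  also have "crit B (\<lambda>i. w i + (if i = j then b else 0)) \<le> crit B ?z'"
    by (intro crit_mono) (auto simp: w_def)
  finally show ?thesis unfolding D by simp
qed

text \<open>One factor 1 / 2 in \<open>p j * m' j / 4\<close> is the acceptance threshold, the other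
  the rate in \<open>crit_compare\<close>; the summand 1 / 4 absorbs the rounding in
  \<open>m' j div 2\<close>.\<close>

definition deviation :: "real \<Rightarrow> (nat \<Rightarrow> nat) \<Rightarrow> (nat \<Rightarrow> nat) \<Rightarrow> nat \<Rightarrow> real" where
  "deviation \<theta> m m' j = exp (\<theta> * ((\<Sum>i\<in>{1..k}. \<bar>real (m i) - real (m' i)\<bar>) - p j * real (m' j) / 4 + 1 / 4))"

text \<open>Acceptance means that the sampled optimum serves more than \<open>b = m' j div 2\<close>
  customers of type \<open>j\<close>, so \<open>crit\<close> with \<open>b\<close> of them is still
  at most \<open>q j\<close>. The true state to be judged contains no future type \<open>j\<close>
  customer, so these \<open>b\<close> are the safety margin.\<close>

lemma accept_loss:
  assumes opt: "optimal_index_solution k v p B y (\<lambda>i. m' i + (if i = j then 1 else 0)) x"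
    and j: "j \<in> {1..k}" and x: "real (m' j + 1) / 2 \<le> real (x j)" and \<theta>: "0 \<le> \<theta>" "\<theta> \<le> 1"
  shows "index_opt B y (m(j := m j + 1)) \<le> index_opt B (y(j := y j + 1)) m + deviation \<theta> m m' j"
proof -
  define b where "b = m' j div 2"
  have pj: "0 < p j" "p j \<le> 1" using p_bounds[OF j] by auto
  let ?z = "\<lambda>i. y i + (if i < j then m i else 0)"
  let ?z' = "\<lambda>i. y i + (if i < j then m' i else if i = j then b else 0)"
  have "real (m' j + 1) \<le> real (2 * x j)" using x by simp
  then have bx: "b < x j" unfolding b_def of_nat_le_iff by linarith
  have eq: "?z' = (\<lambda>i. y i + (if i < j then m' i + (if i = j then 1 else 0) else if i = j then b else 0))"
    by auto
  have "crit B ?z' \<le> q j" unfolding eq by (rule optimal_index_crit_le[OF opt j bx])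
  moreover have "crit B ?z \<le> crit B ?z' +
      exp (\<theta> * ((\<Sum>i\<in>{1..k}. if i < j then real (m i - m' i) else 0) - p j * real b / 2))"
    by (rule crit_compare[OF j \<theta>])
  moreover have "\<dots> \<le> crit B ?z' + deviation \<theta> m m' j"
  proof -
    have "(\<Sum>i\<in>{1..k}. if i < j then real (m i - m' i) else 0) \<le> (\<Sum>i\<in>{1..k}. \<bar>real (m i) - real (m' i)\<bar>)"
      by (intro sum_mono) auto
    moreover have "p j * real (m' j) / 4 - 1 / 4 \<le> p j * real b / 2"
    proof -
      have "real (m' j) \<le> 2 * real b + 1" unfolding b_def by linarith
      then have "p j * real (m' j) \<le> p j * (2 * real b + 1)" using pj by (intro mult_left_mono) auto
      also have "\<dots> \<le> 2 * (p j * real b) + 1" using pj by (simp add: algebra_simps)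
      finally show ?thesis by simp
    qed
    ultimately have "\<theta> * ((\<Sum>i\<in>{1..k}. if i < j then real (m i - m' i) else 0) - p j * real b / 2)
      \<le> \<theta> * ((\<Sum>i\<in>{1..k}. \<bar>real (m i) - real (m' i)\<bar>) - p j * real (m' j) / 4 + 1 / 4)"
      using \<theta> by (intro mult_left_mono) auto
    then show ?thesis by (simp add: deviation_def)
  qed
  ultimately have "crit B ?z - q j \<le> deviation \<theta> m m' j" by linarith
  then have "p j * (crit B ?z - q j) \<le> p j * deviation \<theta> m m' j" using pj by (intro mult_left_mono) auto
  also have "\<dots> \<le> deviation \<theta> m m' j" using pj by (simp add: deviation_def mult_le_cancel_right1)
  finally have "max 0 (p j * (crit B ?z - q j)) \<le> deviation \<theta> m m' j" by (simp add: deviation_def)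
  then show ?thesis using index_opt_accept[OF j, of B y m] by linarith
qed

text \<open>Here the true state contains all \<open>m j\<close> future customers of type
  \<open>j\<close> and the sampled one only \<open>b\<close>, so the margin is
  \<open>m j - b\<close>. Expressing it through \<open>m' j\<close> is paid for by the coordinate
  \<open>j\<close> of the l1 distance, which the sum over \<open>i < j\<close> leaves free.\<close>

lemma reject_loss:
  assumes opt: "optimal_index_solution k v p B y (\<lambda>i. m' i + (if i = j then 1 else 0)) x"
    and j: "j \<in> {1..k}" and x: "real (x j) < real (m' j + 1) / 2" and \<theta>: "0 \<le> \<theta>" "\<theta> \<le> 1"
  shows "index_opt B y (m(j := m j + 1)) \<le> index_opt B y m + deviation \<theta> m m' j"
proof -
  define b where "b = m' j div 2"
  have pj: "0 < p j" "p j \<le> 1" using p_bounds[OF j] by auto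
  let ?z = "\<lambda>i. y i + (if i \<le> j then m i else 0)"
  let ?z' = "\<lambda>i. y i + (if i < j then m' i else if i = j then b else 0)"
  let ?D = "\<Sum>i\<in>{1..k}. \<bar>real (m i) - real (m' i)\<bar>"
  let ?D' = "\<Sum>i\<in>{1..k}. if i < j then real (m' i - m i) else 0"
  have "real (2 * x j) < real (m' j + 1)" using x by simp
  then have bx: "x j \<le> b" "b < m' j + 1" unfolding b_def of_nat_less_iff by linarith+
  have eq: "?z' = (\<lambda>i. y i + (if i < j then m' i + (if i = j then 1 else 0) else if i = j then b else 0))"
    by auto
  have "q j \<le> crit B ?z'" unfolding eq using bx by (intro optimal_index_crit_ge[OF opt j]) auto
  moreover have "crit B ?z' \<le> crit B ?z + exp (\<theta> * (?D' - p j * (real (m j) - real b) / 2))"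
  proof (cases "b \<le> m j")
    case True
    \<comment> \<open>The \<open>b\<close> type \<open>j\<close> customers common to both states are
      moved into the past; \<open>crit_compare\<close> then sees \<open>m j - b\<close> extra
      ones.\<close>
    have "?z' = (\<lambda>i. (y(j := y j + b)) i + (if i < j then m' i else 0))" by auto
    moreover have "(\<lambda>i. (y(j := y j + b)) i + (if i < j then m i else if i = j then m j - b else 0)) = ?z"
      using True by auto
    ultimately show ?thesis
      using crit_compare[OF j \<theta>, of B "y(j := y j + b)" m' m "m j - b"] True by (simp add: of_nat_diff)
  next
    case False
    \<comment> \<open>Without a margin the exponent is nonnegative, so the error term is at least 1
      and covers any difference of probabilities.\<close>
    have "0 \<le> ?D'" by (intro sum_nonneg) auto
    moreover have "p j * (real (m j) - real b) \<le> 0" using False pj by (intro mult_nonneg_nonpos) auto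
    ultimately have "0 \<le> \<theta> * (?D' - p j * (real (m j) - real b) / 2)" using \<theta> by (intro mult_nonneg_nonneg) auto
    then show ?thesis using crit_le_1[of B ?z'] crit_nonneg[of B ?z]
      by (smt (verit) one_le_exp_iff)
  qed
  moreover have "exp (\<theta> * (?D' - p j * (real (m j) - real b) / 2)) \<le> deviation \<theta> m m' j"
  proof -
    have "?D' + \<bar>real (m j) - real (m' j)\<bar> \<le> ?D"
    proof -
      have "\<bar>real (m j) - real (m' j)\<bar> = (\<Sum>i\<in>{1..k}. if i = j then \<bar>real (m i) - real (m' i)\<bar> else 0)"
        using j by simp
      then have "?D' + \<bar>real (m j) - real (m' j)\<bar> = (\<Sum>i\<in>{1..k}. (if i < j then real (m' i - m i) else 0) +
          (if i = j then \<bar>real (m i) - real (m' i)\<bar> else 0))" by (simp only: sum.distrib)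
      also have "\<dots> \<le> ?D" by (intro sum_mono) auto
      finally show ?thesis .
    qed
    moreover have "p j * real (m' j) / 4 - p j * (real (m j) - real b) / 2 \<le> \<bar>real (m j) - real (m' j)\<bar>"
    proof -
      have "real b \<le> real (m' j) / 2" unfolding b_def by linarith
      then have "real (m' j) / 2 - (real (m j) - real b) \<le> \<bar>real (m j) - real (m' j)\<bar>" by linarith
      then have "p j * (real (m' j) / 2 - (real (m j) - real b)) \<le> p j * \<bar>real (m j) - real (m' j)\<bar>"
        using pj by (intro mult_left_mono) auto
      also have "\<dots> \<le> \<bar>real (m j) - real (m' j)\<bar>" using pj by (simp add: mult_left_le_one_le)
      finally have "p j * (real (m' j) / 2 - (real (m j) - real b)) / 2 \<le> \<bar>real (m j) - real (m' j)\<bar>"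
        by linarith
      then show ?thesis by (simp add: field_simps)
    qed
    ultimately have "\<theta> * (?D' - p j * (real (m j) - real b) / 2) \<le> \<theta> * (?D - p j * real (m' j) / 4 + 1 / 4)"
      using \<theta> by (intro mult_left_mono) auto
    then show ?thesis by (simp add: deviation_def)
  qed
  ultimately have "q j - crit B ?z \<le> deviation \<theta> m m' j" by linarith
  then have "p j * (q j - crit B ?z) \<le> p j * deviation \<theta> m m' j" using pj by (intro mult_left_mono) auto
  also have "\<dots> \<le> deviation \<theta> m m' j" using pj by (simp add: deviation_def mult_le_cancel_right1)
  finally have "max 0 (p j * (q j - crit B ?z)) \<le> deviation \<theta> m m' j" by (simp add: deviation_def)
  then show ?thesis using index_opt_reject[OF j, of B y m] by linarith
qed

section \<open>The policy along a whole arrival sequence\<close>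

lemma arrival_count_step:
  assumes "t < T"
  shows "arrival_count A (Suc t) T =
    (arrival_count A (Suc (Suc t)) T)(A (Suc t) := arrival_count A (Suc (Suc t)) T (A (Suc t)) + 1)"
proof
  fix i
  have "{Suc t..T} = insert (Suc t) {Suc (Suc t)..T}" using assms by auto
  then have "{u \<in> {Suc t..T}. A u = i} =
    (if A (Suc t) = i then insert (Suc t) {u \<in> {Suc (Suc t)..T}. A u = i} else {u \<in> {Suc (Suc t)..T}. A u = i})"
    by auto
  then show "arrival_count A (Suc t) T i =
    ((arrival_count A (Suc (Suc t)) T)(A (Suc t) := arrival_count A (Suc (Suc t)) T (A (Suc t)) + 1)) i"
    by (auto simp: arrival_count_def)
qed

lemma policy_step:
  assumes sel: "valid_selection k v p B sel" and "t < T" "A (Suc t) \<in> {1..k}" and \<theta>: "0 \<le> \<theta>" "\<theta> \<le> 1"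
  shows "index_opt B (policy_state T sel A A' t) (arrival_count A (Suc t) T)
    \<le> index_opt B (policy_state T sel A A' (Suc t)) (arrival_count A (Suc (Suc t)) T)
      + deviation \<theta> (arrival_count A (Suc (Suc t)) T) (arrival_count A' (Suc (Suc t)) T) (A (Suc t))"
proof -
  define y where "y = policy_state T sel A A' t"
  define j where "j = A (Suc t)"
  define m' where "m' = arrival_count A' (Suc (Suc t)) T"
  \<comment> \<open>The current arrival is known to the policy, so only counts from period
    \<open>Suc (Suc t)\<close> on can differ.\<close>
  have n: "estimated_arrivals T A A' (Suc t) = (\<lambda>i. m' i + (if i = j then 1 else 0))"
    by (auto simp: estimated_arrivals_def m'_def j_def)
  define x where "x = sel (map A [1..<Suc (Suc t)]) A' y (\<lambda>i. m' i + (if i = j then 1 else 0))"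
  have opt: "optimal_index_solution k v p B y (\<lambda>i. m' i + (if i = j then 1 else 0)) x"
    using sel unfolding valid_selection_def x_def by blast
  have j: "j \<in> {1..k}" using assms by (simp add: j_def)
  have st: "policy_state T sel A A' (Suc t) =
     (if real (m' j + 1) / 2 \<le> real (x j) then y(j := y j + 1) else y)"
    by (simp add: n x_def Let_def flip: y_def j_def)
  show ?thesis
    unfolding arrival_count_step[OF \<open>t < T\<close>] st
    using accept_loss[OF opt j _ \<theta>] reject_loss[OF opt j _ \<theta>]
    by (auto simp flip: y_def j_def m'_def simp: not_le)
qed

lemma policy_loss:
  assumes "valid_selection k v p B sel" "\<forall>u\<in>{1..T}. A u \<in> {1..k}" and \<theta>: "0 \<le> \<theta>" "\<theta> \<le> 1"
  shows "index_opt B (\<lambda>_. 0) (arrival_count A 1 T) \<le> objective k v p B (policy_state T sel A A' T)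
    + (\<Sum>t<T. deviation \<theta> (arrival_count A (Suc (Suc t)) T) (arrival_count A' (Suc (Suc t)) T) (A (Suc t)))"
proof -
  let ?dev = "\<lambda>t. deviation \<theta> (arrival_count A (Suc (Suc t)) T) (arrival_count A' (Suc (Suc t)) T) (A (Suc t))"
  have "index_opt B (\<lambda>_. 0) (arrival_count A 1 T)
      \<le> index_opt B (policy_state T sel A A' t) (arrival_count A (Suc t) T) + (\<Sum>t<t. ?dev t)"
    if "t \<le> T" for t
    using that
  proof (induction t)
    case (Suc t)
    then show ?case using policy_step[OF assms(1), of t T A \<theta> A'] assms(2) \<theta> by simp
  qed simp
  from this[of T] have "index_opt B (\<lambda>_. 0) (arrival_count A 1 T)
      \<le> index_opt B (policy_state T sel A A' T) (arrival_count A (Suc T) T) + (\<Sum>t<T. ?dev t)" by simp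
  moreover obtain x where "index_solution k (arrival_count A (Suc T) T) x" 
    and "index_opt B (policy_state T sel A A' T) (arrival_count A (Suc T) T) 
      = objective k v p B (\<lambda>j. policy_state T sel A A' T j + x j)"
    by (rule index_opt_attained)
  \<comment> \<open>Beyond the horizon no customer remains, so the potential has become the
    objective itself.\<close>
  moreover have "x j = 0" if "j \<in> {1..k}" for j
    using that \<open>index_solution k (arrival_count A (Suc T) T) x\<close>
    by (auto simp: index_solution_def offline_feasible_def arrival_count_def PiE_def Pi_def)
  then have "objective k v p B (\<lambda>j. policy_state T sel A A' T j + x j) = objective k v p B (policy_state T sel A A' T)"
    by (intro objective_cong) simp
  ultimately show ?thesis by simp
qed

subsection \<open>Expected loss\<close>

lemma set_type_pmf: "set_pmf (type_pmf k lam) \<subseteq> {1..k}"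
  using pmf_type_pmf[OF valid] by (auto simp: set_pmf_eq split: if_splits)

lemma finite_arrivals_pmf: "finite (set_pmf (arrivals_pmf k lam T))"
proof -
  have "finite (set_pmf (type_pmf k lam))" using set_type_pmf finite_subset by blast
  then show ?thesis
    unfolding arrivals_pmf_def by (subst set_Pi_pmf) (auto intro!: finite_PiE_dflt)
qed

lemma integrable_arrivals: "integrable (measure_pmf (arrivals_pmf k lam T)) (f :: _ \<Rightarrow> real)"
  by (intro integrable_measure_pmf_finite finite_arrivals_pmf)

lemma arrivals_in_types: "A \<in> set_pmf (arrivals_pmf k lam T) \<Longrightarrow> u \<in> {1..T} \<Longrightarrow> A u \<in> {1..k}"
  using set_type_pmf unfolding arrivals_pmf_def by (subst (asm) set_Pi_pmf) (auto simp: PiE_dflt_def)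

lemma expectation_arrivals_prod:
  fixes f :: "nat \<Rightarrow> real"
  assumes "\<And>j. 0 \<le> f j" "1 \<le> s"
  shows "measure_pmf.expectation (arrivals_pmf k lam T) (\<lambda>A. \<Prod>u\<in>{s..T}. f (A u))
    = (\<Sum>j\<in>{1..k}. lam j * f j) ^ (Suc T - s)"
proof -
  have sub: "{1..T} \<inter> {s..T} = {s..T}" using assms(2) by auto
  have fin: "finite (set_pmf (type_pmf k lam))" using set_type_pmf finite_subset by blast
  have "measure_pmf.expectation (type_pmf k lam) f = (\<Sum>j\<in>{1..k}. f j * pmf (type_pmf k lam) j)"
    using set_type_pmf by (intro integral_measure_pmf_real) auto
  also have "\<dots> = (\<Sum>j\<in>{1..k}. lam j * f j)"
    by (intro sum.cong) (auto simp: pmf_type_pmf[OF valid])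
  finally have E: "measure_pmf.expectation (type_pmf k lam) f = (\<Sum>j\<in>{1..k}. lam j * f j)" .
  have "measure_pmf.expectation (arrivals_pmf k lam T) (\<lambda>A. \<Prod>u\<in>{s..T}. f (A u)) =
    measure_pmf.expectation (arrivals_pmf k lam T) (\<lambda>A. \<Prod>u\<in>{1..T}. if u \<in> {s..T} then f (A u) else 1)"
    by (subst prod.inter_restrict[symmetric]) (simp_all only: sub finite_atLeastAtMost)
  also have "\<dots> = (\<Prod>u\<in>{1..T}. measure_pmf.expectation (type_pmf k lam) (\<lambda>a. if u \<in> {s..T} then f a else 1))"
    unfolding arrivals_pmf_def
    by (intro expectation_prod_Pi_pmf integrable_measure_pmf_finite fin) (use assms in auto)
  also have "\<dots> = (\<Prod>u\<in>{1..T}. if u \<in> {s..T} then (\<Sum>j\<in>{1..k}. lam j * f j) else 1)"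
    by (intro prod.cong) (auto simp: E[simplified])
  also have "\<dots> = (\<Prod>u\<in>{s..T}. (\<Sum>j\<in>{1..k}. lam j * f j))"
    by (subst prod.inter_restrict[symmetric]) (simp_all only: sub finite_atLeastAtMost)
  finally show ?thesis by simp
qed

text \<open>Summing over all sign patterns \<open>S\<close> removes the absolute values, so that the bound factorizes over
  the periods.\<close>

lemma deviation_le:
  assumes A: "\<forall>u\<in>{s..T}. A u \<in> {1..k}" "\<forall>u\<in>{s..T}. A' u \<in> {1..k}" and j: "j \<in> {1..k}"
  shows "deviation \<theta> (arrival_count A s T) (arrival_count A' s T) j \<le>
    (\<Sum>S\<in>Pow {1..k}. exp (\<theta> / 4) * (\<Prod>u\<in>{s..T}. exp (\<theta> * plus_minus S (A u)))
      * (\<Prod>u\<in>{s..T}. exp (\<theta> * (- plus_minus S (A' u) - (if A' u = j then p j / 4 else 0)))))"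
    (is "_ \<le> (\<Sum>S\<in>_. ?term S)")
proof -
  define m where "m = arrival_count A s T"
  define m' where "m' = arrival_count A' s T"
  define S where "S = {i \<in> {1..k}. m' i \<le> m i}"
  have "(\<Sum>i\<in>{1..k}. \<bar>real (m i) - real (m' i)\<bar>) - p j * real (m' j) / 4
     = (\<Sum>i\<in>{1..k}. plus_minus S i * real (m i)) + (\<Sum>i\<in>{1..k}. (- plus_minus S i - (if i = j then p j / 4 else 0)) * real (m' i))"
  proof -
    have "p j * real (m' j) / 4 = (\<Sum>i\<in>{1..k}. if i = j then p j / 4 * real (m' i) else 0)"
      using j by simp
    then have "(\<Sum>i\<in>{1..k}. \<bar>real (m i) - real (m' i)\<bar>) - p j * real (m' j) / 4
        = (\<Sum>i\<in>{1..k}. \<bar>real (m i) - real (m' i)\<bar> - (if i = j then p j / 4 * real (m' i) else 0))"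
      by (simp only: sum_subtractf)
    also have "\<dots> = (\<Sum>i\<in>{1..k}. plus_minus S i * real (m i) + (- plus_minus S i - (if i = j then p j / 4 else 0)) * real (m' i))"
      by (rule sum.cong) (auto simp: S_def plus_minus_def left_diff_distrib)
    finally show ?thesis by (simp only: sum.distrib)
  qed
  also have "\<dots> = (\<Sum>u\<in>{s..T}. plus_minus S (A u)) + (\<Sum>u\<in>{s..T}. - plus_minus S (A' u) - (if A' u = j then p j / 4 else 0))"
    unfolding m_def m'_def by (subst (1 2) sum_arrival_count) (use A in auto)
  finally have "deviation \<theta> m m' j = exp (\<theta> / 4 + (\<Sum>u\<in>{s..T}. \<theta> * plus_minus S (A u))
      + (\<Sum>u\<in>{s..T}. \<theta> * (- plus_minus S (A' u) - (if A' u = j then p j / 4 else 0))))"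
    unfolding deviation_def sum_distrib_left[symmetric] by (simp add: algebra_simps)
  also have "\<dots> = ?term S"
    by (simp add: exp_add exp_sum)
  also have "\<dots> \<le> (\<Sum>S\<in>Pow {1..k}. ?term S)"
  proof (rule member_le_sum)
    show "S \<in> Pow {1..k}" by (auto simp: S_def)
  qed (auto intro!: mult_nonneg_nonneg prod_nonneg)
  finally show ?thesis by (simp add: m_def m'_def)
qed

text \<open>True and sampled arrivals have the same law, so the first-order terms of the signs
  cancel and the drift \<open>- \<theta> * (lam j * p j) / 4\<close> remains. The quadratic terms
  cost \<open>8 * \<theta>\<^sup>2\<close>; the choice \<theta> = \<kappa> / 64 makes this half of
  the guaranteed drift.\<close>

lemma sign_mgf_le:
  assumes j: "j \<in> {1..k}" and \<kappa>: "\<kappa> \<le> lam j * p j" and \<theta>: "0 \<le> \<theta>" "\<theta> \<le> 1 / 2" "\<theta> = \<kappa> / 64"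
  shows "(\<Sum>i\<in>{1..k}. lam i * exp (\<theta> * plus_minus S i)) *
    (\<Sum>i\<in>{1..k}. lam i * exp (\<theta> * (- plus_minus S i - (if i = j then p j / 4 else 0)))) \<le> exp (- \<theta> * \<kappa> / 8)"
proof -
  let ?\<mu> = "\<Sum>i\<in>{1..k}. lam i * plus_minus S i"
  have lam: "0 \<le> lam i" if "i \<in> {1..k}" for i using lam_pos[OF that] by simp
  have mean: "(\<Sum>i\<in>{1..k}. lam i * (- plus_minus S i - (if i = j then p j / 4 else 0))) = - ?\<mu> - lam j * p j / 4"
  proof -
    have "lam j * p j / 4 = (\<Sum>i\<in>{1..k}. if i = j then lam i * p j / 4 else 0)" using j by simp
    moreover have "(\<Sum>i\<in>{1..k}. lam i * (- plus_minus S i - (if i = j then p j / 4 else 0)))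
        = (\<Sum>i\<in>{1..k}. - (lam i * plus_minus S i) - (if i = j then lam i * p j / 4 else 0))"
      by (rule sum.cong) (auto simp: algebra_simps)
    ultimately show ?thesis by (simp only: sum_subtractf sum_negf)
  qed
  have "(\<Sum>i\<in>{1..k}. lam i * exp (\<theta> * plus_minus S i)) \<le> exp (\<theta> * ?\<mu> + 4 * \<theta>\<^sup>2)"
    by (intro mgf_le lam lam_sum \<theta>) (auto simp: plus_minus_def)
  moreover have "(\<Sum>i\<in>{1..k}. lam i * exp (\<theta> * (- plus_minus S i - (if i = j then p j / 4 else 0))))
      \<le> exp (\<theta> * (\<Sum>i\<in>{1..k}. lam i * (- plus_minus S i - (if i = j then p j / 4 else 0))) + 4 * \<theta>\<^sup>2)"
    using p_bounds[OF j] by (intro mgf_le lam lam_sum \<theta>) (auto simp: plus_minus_def abs_if)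
  ultimately have "(\<Sum>i\<in>{1..k}. lam i * exp (\<theta> * plus_minus S i)) *
    (\<Sum>i\<in>{1..k}. lam i * exp (\<theta> * (- plus_minus S i - (if i = j then p j / 4 else 0))))
    \<le> exp (\<theta> * ?\<mu> + 4 * \<theta>\<^sup>2) * exp (\<theta> * (- ?\<mu> - lam j * p j / 4) + 4 * \<theta>\<^sup>2)"
    unfolding mean using lam by (intro mult_mono sum_nonneg mult_nonneg_nonneg) auto
  also have "\<dots> = exp (8 * \<theta>\<^sup>2 - \<theta> * (lam j * p j) / 4)"
    unfolding exp_add[symmetric] by (simp add: algebra_simps)
  also have "\<dots> \<le> exp (- \<theta> * \<kappa> / 8)"
  proof -
    have "\<theta> * \<kappa> \<le> \<theta> * (lam j * p j)" using \<kappa> \<theta> by (intro mult_left_mono) auto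
    moreover have "8 * \<theta>\<^sup>2 = \<theta> * \<kappa> / 8" unfolding power2_eq_square using \<theta>(3) by simp
    ultimately show ?thesis by simp
  qed
  finally show ?thesis .
qed

lemma clairvoyant_le_index_opt:
  obtains C where "\<And>B T A. clairvoyant_opt k v p B T A \<le> index_opt B (\<lambda>_. 0) (arrival_count A 1 T) + C"
proof -
  obtain C where C: "\<And>B n x. \<forall>j\<in>{1..k}. x j \<le> n j \<Longrightarrow>
    \<exists>x'. index_solution k n x' \<and> objective k v p B x \<le> objective k v p B x' + C"
    using index_gap by blast
  have "clairvoyant_opt k v p B T A \<le> index_opt B (\<lambda>_. 0) (arrival_count A 1 T) + C" for B T A
    unfolding clairvoyant_opt_def
  proof (rule Max.boundedI)
    show "finite (offline_objective k v p B (\<lambda>_. 0) ` offline_feasible k (arrival_count A 1 T))"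
      by (auto simp: offline_feasible_def intro!: finite_PiE)
    show "offline_objective k v p B (\<lambda>_. 0) ` offline_feasible k (arrival_count A 1 T) \<noteq> {}"
      by (auto simp: offline_feasible_def PiE_eq_empty_iff)
    fix r assume "r \<in> offline_objective k v p B (\<lambda>_. 0) ` offline_feasible k (arrival_count A 1 T)"
    then obtain x where x: "x \<in> offline_feasible k (arrival_count A 1 T)" "r = objective k v p B x"
      by (auto simp: offline_objective_def)
    then have "\<forall>j\<in>{1..k}. x j \<le> arrival_count A 1 T j" by (auto simp: offline_feasible_def PiE_def Pi_def)
    from C[OF this] obtain x' where "index_solution k (arrival_count A 1 T) x'"
      "objective k v p B x \<le> objective k v p B x' + C" by blast
    then show "r \<le> index_opt B (\<lambda>_. 0) (arrival_count A 1 T) + C"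
      using index_opt_ge[of "arrival_count A 1 T" x' B "\<lambda>_. 0"] x by simp
  qed
  then show ?thesis using that by blast
qed

theorem expected_regret_bounded:
  "\<exists>M. \<forall>B T sel. 1 \<le> T \<longrightarrow> valid_selection k v p B sel \<longrightarrow>
     measure_pmf.expectation (arrivals_pmf k lam T)
       (\<lambda>A. clairvoyant_opt k v p B T A - policy_obj k lam v p B T sel A) \<le> M"
proof -
  obtain C where C: "\<And>B T A. clairvoyant_opt k v p B T A \<le> index_opt B (\<lambda>_. 0) (arrival_count A 1 T) + C"
    using clairvoyant_le_index_opt by blast
  let ?K = "{1..k}"
  \<comment> \<open>The 1 caps \<kappa>, so that \<theta> stays below 1 / 2.\<close>
  define \<kappa> where "\<kappa> = Min (insert 1 ((\<lambda>j. lam j * p j) ` ?K))"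
  have \<kappa>: "0 < \<kappa>" "\<kappa> \<le> 1"
    using lam_pos p_bounds by (auto simp: \<kappa>_def)
  have \<kappa>j: "\<kappa> \<le> lam j * p j" if "j \<in> ?K" for j
    using that unfolding \<kappa>_def by (intro Min_le) auto
  define \<theta> where "\<theta> = \<kappa> / 64"
  have \<theta>: "0 < \<theta>" "\<theta> \<le> 1 / 2" "\<theta> \<le> 1" using \<kappa> by (auto simp: \<theta>_def)
  define r where "r = exp (- \<theta> * \<kappa> / 8)"
  have r: "0 < r" "r < 1" using \<theta> \<kappa> by (auto simp: r_def)
  define e where "e = exp (\<theta> / 4)"
  \<comment> \<open>\<open>k\<close> current types and \<open>2 ^ k\<close> sign patterns, times a
    geometric series in the number of remaining periods.\<close>
  define M where "M = C + real k * 2 ^ k * e / (1 - r)"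
  have "measure_pmf.expectation (arrivals_pmf k lam T)
       (\<lambda>A. clairvoyant_opt k v p B T A - policy_obj k lam v p B T sel A) \<le> M"
    if sel: "valid_selection k v p B sel" for B T sel
  proof -
    let ?E = "measure_pmf.expectation (arrivals_pmf k lam T)"
    define F where "F t S A = (\<Prod>u\<in>{Suc (Suc t)..T}. exp (\<theta> * plus_minus S (A u)))" for t S A
    define G where "G t S j A' = (\<Prod>u\<in>{Suc (Suc t)..T}.
        exp (\<theta> * (- plus_minus S (A' u) - (if A' u = j then p j / 4 else 0))))" for t S j A'
    have FG: "?E (F t S) * ?E (G t S j) \<le> r ^ (T - Suc t)" if "j \<in> ?K" for t S j
    proof -
      have "?E (F t S) = (\<Sum>i\<in>?K. lam i * exp (\<theta> * plus_minus S i)) ^ (T - Suc t)"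
        unfolding F_def by (subst expectation_arrivals_prod) auto
      moreover have "?E (G t S j)
          = (\<Sum>i\<in>?K. lam i * exp (\<theta> * (- plus_minus S i - (if i = j then p j / 4 else 0)))) ^ (T - Suc t)"
        unfolding G_def by (subst expectation_arrivals_prod) auto
      moreover have "0 \<le> lam i" if "i \<in> ?K" for i using lam_pos[OF that] by simp
      ultimately show ?thesis
        using sign_mgf_le[OF that \<kappa>j[OF that], of \<theta> S] \<theta> \<theta>_def
        by (auto simp: r_def simp flip: power_mult_distrib intro!: power_mono sum_nonneg mult_nonneg_nonneg)
    qed
    have pointwise: "clairvoyant_opt k v p B T A - (C + (\<Sum>t<T. \<Sum>j\<in>?K. \<Sum>S\<in>Pow ?K. e * F t S A * G t S j A'))
        \<le> objective k v p B (policy_state T sel A A' T)"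
      if A: "A \<in> set_pmf (arrivals_pmf k lam T)" and A': "A' \<in> set_pmf (arrivals_pmf k lam T)" for A A'
    proof -
      have in_types: "\<forall>u\<in>{1..T}. A u \<in> ?K" "\<forall>u\<in>{1..T}. A' u \<in> ?K" using A A' arrivals_in_types by blast+
      have "index_opt B (\<lambda>_. 0) (arrival_count A 1 T) \<le> objective k v p B (policy_state T sel A A' T)
        + (\<Sum>t<T. deviation \<theta> (arrival_count A (Suc (Suc t)) T) (arrival_count A' (Suc (Suc t)) T) (A (Suc t)))"
        using \<theta> in_types by (intro policy_loss[OF sel]) auto
      \<comment> \<open>Summing over all types \<open>j\<close> decouples the bound from the current
        arrival, so that it factorizes over later periods only.\<close>
      also have "(\<Sum>t<T. deviation \<theta> (arrival_count A (Suc (Suc t)) T) (arrival_count A' (Suc (Suc t)) T) (A (Suc t)))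
        \<le> (\<Sum>t<T. \<Sum>j\<in>?K. deviation \<theta> (arrival_count A (Suc (Suc t)) T) (arrival_count A' (Suc (Suc t)) T) j)"
      proof (rule sum_mono)
        fix t assume "t \<in> {..<T}"
        then have "A (Suc t) \<in> ?K" using in_types by auto
        then show "deviation \<theta> (arrival_count A (Suc (Suc t)) T) (arrival_count A' (Suc (Suc t)) T) (A (Suc t))
          \<le> (\<Sum>j\<in>?K. deviation \<theta> (arrival_count A (Suc (Suc t)) T) (arrival_count A' (Suc (Suc t)) T) j)"
          by (intro member_le_sum) (auto simp: deviation_def)
      qed
      also have "\<dots> \<le> (\<Sum>t<T. \<Sum>j\<in>?K. \<Sum>S\<in>Pow ?K. e * F t S A * G t S j A')"
        unfolding e_def F_def G_def using in_types by (intro sum_mono deviation_le) auto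
      finally show ?thesis using C[of B T A] by linarith
    qed
    have inner: "clairvoyant_opt k v p B T A - policy_obj k lam v p B T sel A
        \<le> C + (\<Sum>t<T. \<Sum>j\<in>?K. \<Sum>S\<in>Pow ?K. e * ?E (G t S j) * F t S A)"
      if A: "A \<in> set_pmf (arrivals_pmf k lam T)" for A
    proof -
      \<comment> \<open>Averaging over the sample first turns each \<open>G\<close> into a constant;
        the nested expectations express the independence of sample and arrivals.\<close>
      have "?E (\<lambda>A'. clairvoyant_opt k v p B T A - (C + (\<Sum>t<T. \<Sum>j\<in>?K. \<Sum>S\<in>Pow ?K. e * F t S A * G t S j A')))
          \<le> policy_obj k lam v p B T sel A"
        unfolding policy_obj_def using pointwise[OF A]
        by (intro integral_mono_AE integrable_arrivals) (auto simp: AE_measure_pmf_iff)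
      then show ?thesis
        by (simp add: integrable_arrivals Bochner_Integration.integral_sum mult_ac)
    qed
    have "?E (\<lambda>A. clairvoyant_opt k v p B T A - policy_obj k lam v p B T sel A)
        \<le> ?E (\<lambda>A. C + (\<Sum>t<T. \<Sum>j\<in>?K. \<Sum>S\<in>Pow ?K. e * ?E (G t S j) * F t S A))"
      using inner by (intro integral_mono_AE integrable_arrivals) (auto simp: AE_measure_pmf_iff)
    also have "\<dots> = C + (\<Sum>t<T. \<Sum>j\<in>?K. \<Sum>S\<in>Pow ?K. e * (?E (F t S) * ?E (G t S j)))"
      by (simp add: integrable_arrivals Bochner_Integration.integral_sum mult_ac)
    also have "\<dots> \<le> C + (\<Sum>t<T. \<Sum>j\<in>?K. \<Sum>S\<in>Pow ?K. e * r ^ (T - Suc t))"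
      using FG by (intro add_left_mono sum_mono mult_left_mono) (auto simp: e_def)
    also have "\<dots> = C + real k * 2 ^ k * e * (\<Sum>t<T. r ^ (T - Suc t))"
      by (simp add: card_Pow sum_distrib_left mult_ac)
    also have "(\<Sum>t<T. r ^ (T - Suc t)) = (\<Sum>t<T. r ^ t)"
      by (rule sum.nat_diff_reindex)
    also have "\<dots> = (1 - r ^ T) / (1 - r)"
      using r by (subst sum_gp_strict) auto
    also have "C + real k * 2 ^ k * e * ((1 - r ^ T) / (1 - r)) \<le> C + real k * 2 ^ k * e * (1 / (1 - r))"
      using r by (intro add_left_mono mult_left_mono divide_right_mono) (auto simp: e_def)
    also have "\<dots> = M" by (simp add: M_def)
    finally show ?thesis .
  qed
  then show ?thesis by blast
qed

end

theorem theorem2: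
  fixes k :: nat and lam v p :: "nat \<Rightarrow> real"
  assumes "valid_params k lam v p"
  shows "\<exists>M::real. \<forall>(B::nat) (T::nat) (sel::selection_rule).
           1 \<le> T \<longrightarrow> valid_selection k v p B sel \<longrightarrow>
           measure_pmf.expectation (arrivals_pmf k lam T)
             (\<lambda>A. clairvoyant_opt k v p B T A - policy_obj k lam v p B T sel A) \<le> M"
  using overbooking.expected_regret_bounded[OF overbooking.intro, OF assms] .

end
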